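(* Let $n\ge1$ and $m>1$ be integers. Let $h_n\otimes a_m$ denote the symmetrizer on the first $n$ strands times the antisymmetrizer on the last $m$ strands of $\mathsf P^{\otimes(n+m)}$ (the idempotent with image $\mathsf P^{(n)}\mathsf P^{(m)^t}$), and define morphisms in $\mathcal H$ $$\iota^{n,m}_{m}=(h_n\otimes a_m)\circ e_{(n,1^m)}:\mathsf P^{(n,1^m)}\to\mathsf P^{(n)}\mathsf P^{(m)^t},\qquad \iota^{n,m}_{m-1}=m\,(h_n\otimes a_m)\circ e_{(n+1,1^{m-1})}:\mathsf P^{(n+1,1^{m-1})}\to\mathsf P^{(n)}\mathsf P^{(m)^t},$$ $$\rho_{n,m}^{m}=e_{(n,1^m)}\circ(h_n\otimes a_m):\mathsf P^{(n)}\mathsf P^{(m)^t}\to\mathsf P^{(n,1^m)},\qquad \rho_{n,m}^{m-1}=e_{(n+1,1^{m-1})}\circ(h_n\otimes a_m):\mathsf P^{(n)}\mathsf P^{(m)^t}\to\mathsf P^{(n+1,1^{m-1})}.$$ Then: (i) $\rho_{n,m}^m\circ\iota_m^{n,m}=\mathsf 1_{\mathsf P^{(n,1^m)}}$ and $\rho_{n,m}^{m-1}\circ\iota_{m-1}^{n,m}=\mathsf 1_{\mathsf P^{(n+1,1^{m-1})}}$; (ii) $\rho_{n,m}^m\circ\iota_{m-1}^{n,m}=0$ and $\rho_{n,m}^{m-1}\circ\iota_m^{n,m}=0$; (iii) $\mathsf 1_{\mathsf P^{(n)}\mathsf P^{(m)^t}}=\iota_m^{n,m}\circ\rho_{n,m}^m+\iota_{m-1}^{n,m}\circ\rho_{n,m}^{m-1}$.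 Consequently $\mathsf P^{(n)}\mathsf P^{(m)^t}\cong\mathsf P^{(n,1^m)}\oplus\mathsf P^{(n+1,1^{m-1})}$ in $\mathcal H$.
   Context: Let $k$ be a field of characteristic zero. Khovanov's Heisenberg category: $\mathcal H'$ is the additive $k$-linear monoidal category generated by two objects $Q_+,Q_-$. Its morphisms are $k$-linear combinations of oriented planar string diagrams up to isotopy rel boundary (read bottom to top; $Q_+$ is an upward strand, $Q_-$ a downward strand), generated by the crossing of two upward strands and the four oriented cups and caps (so $Q_+,Q_-$ are biadjoint), modulo: (i) the double crossing of two upward strands is the identity; (ii) the braid relation for three upward strands; (iii) the double crossing $Q_+Q_-\to Q_-Q_+\to Q_+Q_-$ is the identity; (iv) the double crossing $Q_-Q_+\to Q_+Q_-\to Q_-Q_+$ is the identity minus the composite of the cap $Q_-Q_+\to\mathsf 1$ followed by the cup $\mathsf 1\to Q_-Q_+$; (v) a counterclockwise circle equals $1$; (vi) an upward strand with a curl on its left is zero. $\mathcal H$ is the Karoubi envelope of $\mathcal H'$. Write $\mathsf P=Q_+$, $\mathsf Q=Q_-$, juxtaposition for $\otimes$, and $\mathsf 1_{\mathsf X}$ for the identity of $\mathsf X$. Relations (i),(ii) give an algebra map $k[S_r]\to\mathrm{End}(\mathsf P^{\otimes r})$. For $\lambda\vdash r$ let $e_\lambda\in k[S_r]$ be the Young idempotent of the row-ordered standard tableau of shape $\lambda$: $e_\lambda=\alpha_\lambda\cdot(\text{row symmetrizer})\cdot(\text{column antisymmetrizer})$ with $\alpha_\lambda$ the scalar making it idempotent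 (strands labelled $1,\dots,r$ from left to right); $\mathsf P^\lambda$ is its image in $\mathsf P^{\otimes r}$. $\mathsf P^{(r)}$ and $\mathsf P^{(r)^t}=\mathsf P^{(1^r)}$ are the images of the complete symmetrizer $h_r$ and complete antisymmetrizer $a_r$ (normalized to be idempotent). $(n,1^m)$ denotes the hook partition with first row $n$ and $m$ further rows of length $1$. *)

theory Defs
  imports
    "HOL-Combinatorics.Permutations"
    "Jordan_Normal_Form.Matrix"
begin

section \<open>Diagrams\<close>

datatype strand = Up | Down

fun opp :: "strand \<Rightarrow> strand" where
  "opp Up = Down"
| "opp Down = Up"

type_synonym word = "strand list"

text \<open>A word, read from left to right, is a tensor product of copies of
  \<open>Q\<^sub>+\<close> (\<open>Up\<close>) and \<open>Q\<^sub>-\<close> (\<open>Down\<close>).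
  Diagrams are formal expressions in the generating morphisms.  \<open>Cup s\<close> creates the
  pair \<open>[s, opp s]\<close> and \<open>Cap s\<close> annihilates it, so these are the four oriented
  cups and caps.  In \<open>g \<diamondop> f\<close> the diagram \<open>g\<close> is stacked on
  top of \<open>f\<close>.\<close>

datatype 'k diagram =
    IdD word
  | Cross
  | Cup strand
  | Cap strand
  | Comp "'k diagram" "'k diagram"  (infixl "\<diamondop>" 70)
  | Tens "'k diagram" "'k diagram"  (infixr "\<boxtimes>" 75)
  | ZeroD
  | Add "'k diagram" "'k diagram"
  | Scale 'k "'k diagram"

inductive typed :: "'k diagram \<Rightarrow> word \<Rightarrow> word \<Rightarrow> bool" where
  "typed (IdD X) X X"
| "typed Cross [Up, Up] [Up, Up]"
| "typed (Cup s) [] [s, opp s]"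
| "typed (Cap s) [s, opp s] []"
| "typed f X Y \<Longrightarrow> typed g Y Z \<Longrightarrow> typed (g \<diamondop> f) X Z"
| "typed f X Y \<Longrightarrow> typed g X' Y' \<Longrightarrow> typed (f \<boxtimes> g) (X @ X') (Y @ Y')"
| "typed ZeroD X Y"
| "typed f X Y \<Longrightarrow> typed g X Y \<Longrightarrow> typed (Add f g) X Y"
| "typed f X Y \<Longrightarrow> typed (Scale c f) X Y"

text \<open>The sideways crossings \<open>Q\<^sub>+ Q\<^sub>- \<rightarrow> Q\<^sub>- Q\<^sub>+\<close> and
  \<open>Q\<^sub>- Q\<^sub>+ \<rightarrow> Q\<^sub>+ Q\<^sub>-\<close>, obtained by bending strands of the
  upward crossing.\<close>

definition cross_UD :: "'k diagram" where
  "cross_UD = (IdD [Down, Up] \<boxtimes> Cap Up) \<diamondop>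
              (IdD [Down] \<boxtimes> Cross \<boxtimes> IdD [Down]) \<diamondop>
              (Cup Down \<boxtimes> IdD [Up, Down])"

definition cross_DU :: "'k diagram" where
  "cross_DU = (Cap Down \<boxtimes> IdD [Up, Down]) \<diamondop>
              (IdD [Down] \<boxtimes> Cross \<boxtimes> IdD [Down]) \<diamondop>
              (IdD [Down, Up] \<boxtimes> Cup Up)"

text \<open>Two nested cups or caps, with outer boundary \<open>[s, s, opp s, opp s]\<close>.\<close>

definition Cup2 :: "strand \<Rightarrow> 'k diagram" where
  "Cup2 s = (IdD [s] \<boxtimes> Cup s \<boxtimes> IdD [opp s]) \<diamondop> Cup s"

definition Cap2 :: "strand \<Rightarrow> 'k diagram" where
  "Cap2 s = Cap s \<diamondop> (IdD [s] \<boxtimes> Cap s \<boxtimes> IdD [opp s])"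

text \<open>Equality of diagrams in \<open>\<H>'\<close>.  Planar isotopy rel boundary amounts to the
  axioms of a strict monoidal category, the zigzag identities (biadjointness) and the cyclicity of
  the crossing (its two rotations by a half turn agree).

  The linear and associativity axioms are imposed on all expressions, well-typed or not, and
  ill-matched composites are set to zero.  The quotient is therefore the direct sum of all the
  morphism spaces \<open>Hom(X, Y)\<close>, with the product extending composition by zero; well-typed
  expressions acquire no additional identifications.  The interchange law does need its typing
  hypotheses.\<close>

inductive deq :: "'k::field diagram \<Rightarrow> 'k diagram \<Rightarrow> bool" (infix "\<doteq>" 50) where
  refl: "f \<doteq> f"
| sym: "f \<doteq> g \<Longrightarrow> g \<doteq> f"
| trans: "f \<doteq> g \<Longrightarrow> g \<doteq> h \<Longrightarrow> f \<doteq> h"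
| cong_Comp: "f \<doteq> f' \<Longrightarrow> g \<doteq> g' \<Longrightarrow> g \<diamondop> f \<doteq> g' \<diamondop> f'"
| cong_Tens: "f \<doteq> f' \<Longrightarrow> g \<doteq> g' \<Longrightarrow> f \<boxtimes> g \<doteq> f' \<boxtimes> g'"
| cong_Add: "f \<doteq> f' \<Longrightarrow> g \<doteq> g' \<Longrightarrow> Add f g \<doteq> Add f' g'"
| cong_Scale: "f \<doteq> f' \<Longrightarrow> Scale c f \<doteq> Scale c f'"
  \<comment> \<open>vector space structure\<close>
| Add_assoc: "Add (Add f g) h \<doteq> Add f (Add g h)"
| Add_commute: "Add f g \<doteq> Add g f"
| Add_Zero: "Add ZeroD f \<doteq> f"
| Add_neg: "Add (Scale (- 1) f) f \<doteq> ZeroD"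
| Scale_Add: "Scale c (Add f g) \<doteq> Add (Scale c f) (Scale c g)"
| Scale_plus: "Scale (c + d) f \<doteq> Add (Scale c f) (Scale d f)"
| Scale_Scale: "Scale c (Scale d f) \<doteq> Scale (c * d) f"
| Scale_one: "Scale 1 f \<doteq> f"
  \<comment> \<open>bilinearity of composition and tensor product\<close>
| Comp_Add_left: "Add f g \<diamondop> h \<doteq> Add (f \<diamondop> h) (g \<diamondop> h)"
| Comp_Add_right: "h \<diamondop> Add f g \<doteq> Add (h \<diamondop> f) (h \<diamondop> g)"
| Comp_Scale_left: "Scale c f \<diamondop> g \<doteq> Scale c (f \<diamondop> g)"
| Comp_Scale_right: "f \<diamondop> Scale c g \<doteq> Scale c (f \<diamondop> g)"
| Tens_Add_left: "Add f g \<boxtimes> h \<doteq> Add (f \<boxtimes> h) (g \<boxtimes> h)"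
| Tens_Add_right: "h \<boxtimes> Add f g \<doteq> Add (h \<boxtimes> f) (h \<boxtimes> g)"
| Tens_Scale_left: "Scale c f \<boxtimes> g \<doteq> Scale c (f \<boxtimes> g)"
| Tens_Scale_right: "f \<boxtimes> Scale c g \<doteq> Scale c (f \<boxtimes> g)"
  \<comment> \<open>strict monoidal category\<close>
| Comp_assoc: "(h \<diamondop> g) \<diamondop> f \<doteq> h \<diamondop> (g \<diamondop> f)"
| Comp_Id_left: "typed f X Y \<Longrightarrow> IdD Y \<diamondop> f \<doteq> f"
| Comp_Id_right: "typed f X Y \<Longrightarrow> f \<diamondop> IdD X \<doteq> f"
| Comp_mismatch: "typed f X Y \<Longrightarrow> typed g Z W \<Longrightarrow> Y \<noteq> Z \<Longrightarrow> g \<diamondop> f \<doteq> ZeroD"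
| Tens_assoc: "(f \<boxtimes> g) \<boxtimes> h \<doteq> f \<boxtimes> (g \<boxtimes> h)"
| Tens_unit_left: "IdD [] \<boxtimes> f \<doteq> f"
| Tens_unit_right: "f \<boxtimes> IdD [] \<doteq> f"
| Tens_Id: "IdD X \<boxtimes> IdD Y \<doteq> IdD (X @ Y)"
| interchange:
    "typed f X Y \<Longrightarrow> typed g Y Z \<Longrightarrow> typed f' X' Y' \<Longrightarrow> typed g' Y' Z' \<Longrightarrow>
     (g \<boxtimes> g') \<diamondop> (f \<boxtimes> f') \<doteq> (g \<diamondop> f) \<boxtimes> (g' \<diamondop> f')"
  \<comment> \<open>isotopy\<close>
| zigzag_left: "(Cap s \<boxtimes> IdD [s]) \<diamondop> (IdD [s] \<boxtimes> Cup (opp s)) \<doteq> IdD [s]"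
| zigzag_right: "(IdD [s] \<boxtimes> Cap (opp s)) \<diamondop> (Cup s \<boxtimes> IdD [s]) \<doteq> IdD [s]"
| cyclicity:
    "(Cap2 Down \<boxtimes> IdD [Down, Down]) \<diamondop>
     (IdD [Down, Down] \<boxtimes> Cross \<boxtimes> IdD [Down, Down]) \<diamondop>
     (IdD [Down, Down] \<boxtimes> Cup2 Up)
     \<doteq>
     (IdD [Down, Down] \<boxtimes> Cap2 Up) \<diamondop>
     (IdD [Down, Down] \<boxtimes> Cross \<boxtimes> IdD [Down, Down]) \<diamondop>
     (Cup2 Down \<boxtimes> IdD [Down, Down])"
  \<comment> \<open>local relations\<close>
| double_crossing: "Cross \<diamondop> Cross \<doteq> IdD [Up, Up]"
| braid:
    "(Cross \<boxtimes> IdD [Up]) \<diamondop> (IdD [Up] \<boxtimes> Cross) \<diamondop> (Cross \<boxtimes> IdD [Up])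
     \<doteq> (IdD [Up] \<boxtimes> Cross) \<diamondop> (Cross \<boxtimes> IdD [Up]) \<diamondop> (IdD [Up] \<boxtimes> Cross)"
| double_crossing_UD: "cross_DU \<diamondop> cross_UD \<doteq> IdD [Up, Down]"
| double_crossing_DU:
    "cross_UD \<diamondop> cross_DU \<doteq> Add (IdD [Down, Up]) (Scale (- 1) (Cup Down \<diamondop> Cap Down))"
| ccw_circle: "Cap Down \<diamondop> Cup Down \<doteq> IdD []"
| left_curl:
    "(Cap Down \<boxtimes> IdD [Up]) \<diamondop> (IdD [Down] \<boxtimes> Cross) \<diamondop> (Cup Down \<boxtimes> IdD [Up]) \<doteq> ZeroD"

quotient_type (overloaded) 'k mor = "'k::field diagram" / deq
  by (rule equivpI) (auto intro: reflpI sympI transpI deq.refl deq.sym deq.trans)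

section \<open>The category of words\<close>

text \<open>\<open>'k mor\<close> is the direct sum of the morphism spaces between words; \<open>*\<close> is
  composition.\<close>

instantiation mor :: (field) ring
begin

lift_definition zero_mor :: "'a mor" is ZeroD .
lift_definition plus_mor :: "'a mor \<Rightarrow> 'a mor \<Rightarrow> 'a mor" is Add by (rule deq.cong_Add)
lift_definition uminus_mor :: "'a mor \<Rightarrow> 'a mor" is "Scale (- 1)" by (rule deq.cong_Scale)
definition minus_mor :: "'a mor \<Rightarrow> 'a mor \<Rightarrow> 'a mor" where "minus_mor f g = f + - g"
lift_definition times_mor :: "'a mor \<Rightarrow> 'a mor \<Rightarrow> 'a mor" is Comp by (rule deq.cong_Comp)

instance
proof
  fix f g h :: "'a mor"
  show "f + g + h = f + (g + h)" by transfer (rule deq.Add_assoc)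
  show "f + g = g + f" by transfer (rule deq.Add_commute)
  show "0 + f = f" by transfer (rule deq.Add_Zero)
  show "- f + f = 0" by transfer (rule deq.Add_neg)
  show "f - g = f + - g" by (rule minus_mor_def)
  show "f * g * h = f * (g * h)" by transfer (rule deq.Comp_assoc)
  show "(f + g) * h = f * h + g * h" by transfer (rule deq.Comp_Add_left)
  show "f * (g + h) = f * g + f * h" by transfer (rule deq.Comp_Add_right)
qed

end

lift_definition scale :: "'k::field \<Rightarrow> 'k mor \<Rightarrow> 'k mor" is Scale by (rule deq.cong_Scale)
lift_definition tens :: "'k::field mor \<Rightarrow> 'k mor \<Rightarrow> 'k mor" is Tens by (rule deq.cong_Tens)
lift_definition idm :: "word \<Rightarrow> 'k::field mor" is IdD .
lift_definition crossing :: "'k::field mor" is Cross .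

definition whom :: "word \<Rightarrow> word \<Rightarrow> 'k::field mor set" where
  "whom X Y = {abs_mor t |t. typed t X Y}"

section \<open>The additive monoidal category \<open>\<H>'\<close>\<close>

text \<open>Objects are formal finite direct sums (lists) of words.  A morphism from \<open>Xs\<close> to
  \<open>Ys\<close> is a matrix whose \<open>(i, j)\<close> entry is a morphism from the \<open>j\<close>-th summand
  of \<open>Xs\<close> to the \<open>i\<close>-th summand of \<open>Ys\<close>; composition is the matrix
  product.\<close>

definition ahom :: "word list \<Rightarrow> word list \<Rightarrow> 'k::field mor mat set" where
  "ahom Xs Ys = {A \<in> carrier_mat (length Ys) (length Xs).
     \<forall>i < length Ys. \<forall>j < length Xs. A $$ (i, j) \<in> whom (Xs ! j) (Ys ! i)}"

definition ascale :: "'k::field \<Rightarrow> 'k mor mat \<Rightarrow> 'k mor mat" where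
  "ascale c A = map_mat (scale c) A"

definition atens_obj :: "word list \<Rightarrow> word list \<Rightarrow> word list" where
  "atens_obj Xs Ys = concat (map (\<lambda>X. map (\<lambda>Y. X @ Y) Ys) Xs)"

text \<open>The Kronecker product, in the ordering of summands of \<open>atens_obj\<close>.\<close>

definition atens :: "'k::field mor mat \<Rightarrow> 'k mor mat \<Rightarrow> 'k mor mat" where
  "atens A B = mat (dim_row A * dim_row B) (dim_col A * dim_col B)
     (\<lambda>(i, j). tens (A $$ (i div dim_row B, j div dim_col B)) (B $$ (i mod dim_row B, j mod dim_col B)))"

definition single :: "'k::field mor \<Rightarrow> 'k mor mat" where
  "single f = mat 1 1 (\<lambda>_. f)"

section \<open>The Karoubi envelope \<open>\<H>\<close>\<close>

text \<open>An object is a pair of an object of \<open>\<H>'\<close> and an idempotent of it, the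
  idempotent being the identity morphism of the pair.  Morphisms are morphisms of \<open>\<H>'\<close>
  absorbing the idempotents; composition is again the matrix product.\<close>

type_synonym 'k hobj = "word list \<times> 'k mor mat"

definition hobj :: "'k::field hobj set" where
  "hobj = {(X, e). e \<in> ahom X X \<and> e * e = e}"

definition hhom :: "'k::field hobj \<Rightarrow> 'k hobj \<Rightarrow> 'k mor mat set" where
  "hhom A B = {f \<in> ahom (fst A) (fst B). snd B * f * snd A = f}"

definition hid :: "'k::field hobj \<Rightarrow> 'k mor mat" where
  "hid A = snd A"

definition hzero :: "'k::field hobj \<Rightarrow> 'k hobj \<Rightarrow> 'k mor mat" where
  "hzero A B = 0\<^sub>m (length (fst B)) (length (fst A))"

definition htens :: "'k::field hobj \<Rightarrow> 'k hobj \<Rightarrow> 'k hobj" where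
  "htens A B = (atens_obj (fst A) (fst B), atens (snd A) (snd B))"

definition hsum :: "'k::field hobj \<Rightarrow> 'k hobj \<Rightarrow> 'k hobj" where
  "hsum A B = (fst A @ fst B, four_block_mat (snd A) (hzero B A) (hzero A B) (snd B))"

definition hiso :: "'k::field hobj \<Rightarrow> 'k hobj \<Rightarrow> bool" where
  "hiso A B \<longleftrightarrow> A \<in> hobj \<and> B \<in> hobj \<and>
     (\<exists>f \<in> hhom A B. \<exists>g \<in> hhom B A. g * f = hid A \<and> f * g = hid B)"

section \<open>The group algebra of the symmetric group and its action\<close>

text \<open>\<open>S\<^sub>r\<close> acts on \<open>{..<r}\<close> (strands numbered from \<open>0\<close>, left to right).
  Elements of \<open>k[S\<^sub>r]\<close> are coefficient functions vanishing off \<open>S\<^sub>r\<close>.\<close>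

type_synonym 'k grpalg = "(nat \<Rightarrow> nat) \<Rightarrow> 'k"

definition gmult :: "nat \<Rightarrow> 'k::field grpalg \<Rightarrow> 'k grpalg \<Rightarrow> 'k grpalg" where
  "gmult r x y = (\<lambda>\<sigma>. \<Sum>\<tau> | \<tau> permutes {..<r}. x \<tau> * y (inv_into UNIV \<tau> \<circ> \<sigma>))"

definition complete_sym :: "nat \<Rightarrow> 'k::field_char_0 grpalg" where
  "complete_sym r = (\<lambda>\<sigma>. if \<sigma> permutes {..<r} then 1 / fact r else 0)"

definition complete_antisym :: "nat \<Rightarrow> 'k::field_char_0 grpalg" where
  "complete_antisym r = (\<lambda>\<sigma>. if \<sigma> permutes {..<r} then of_int (sign \<sigma>) / fact r else 0)"

text \<open>A partition is a weakly decreasing list of positive integers.  Row and column of the entry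
  \<open>i\<close> in the row-ordered standard tableau (rows filled consecutively from the top).\<close>

fun row_of :: "nat list \<Rightarrow> nat \<Rightarrow> nat" where
  "row_of [] i = 0"
| "row_of (l # ls) i = (if i < l then 0 else Suc (row_of ls (i - l)))"

fun col_of :: "nat list \<Rightarrow> nat \<Rightarrow> nat" where
  "col_of [] i = 0"
| "col_of (l # ls) i = (if i < l then i else col_of ls (i - l))"

definition row_symmetrizer :: "nat list \<Rightarrow> 'k::field grpalg" where
  "row_symmetrizer \<mu> = (\<lambda>\<sigma>. if \<sigma> permutes {..<sum_list \<mu>} \<and>
     (\<forall>i < sum_list \<mu>. row_of \<mu> (\<sigma> i) = row_of \<mu> i) then 1 else 0)"

definition col_antisymmetrizer :: "nat list \<Rightarrow> 'k::field grpalg" where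
  "col_antisymmetrizer \<mu> = (\<lambda>\<sigma>. if \<sigma> permutes {..<sum_list \<mu>} \<and>
     (\<forall>i < sum_list \<mu>. col_of \<mu> (\<sigma> i) = col_of \<mu> i) then of_int (sign \<sigma>) else 0)"

definition young_symmetrizer :: "nat list \<Rightarrow> 'k::field grpalg" where
  "young_symmetrizer \<mu> = gmult (sum_list \<mu>) (row_symmetrizer \<mu>) (col_antisymmetrizer \<mu>)"

definition young_scalar :: "nat list \<Rightarrow> 'k::field" where
  "young_scalar \<mu> = (THE \<alpha>. \<alpha> \<noteq> 0 \<and>
     (let e = (\<lambda>\<sigma>. \<alpha> * young_symmetrizer \<mu> \<sigma>) in gmult (sum_list \<mu>) e e = e))"

definition young_idempotent :: "nat list \<Rightarrow> 'k::field grpalg" where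
  "young_idempotent \<mu> = (\<lambda>\<sigma>. young_scalar \<mu> * young_symmetrizer \<mu> \<sigma>)"

definition hook :: "nat \<Rightarrow> nat \<Rightarrow> nat list" where
  "hook n m = n # replicate m 1"

text \<open>The algebra map \<open>k[S\<^sub>r] \<rightarrow> End(P\<^sup>r)\<close> sends the transposition of
  \<open>i\<close> and \<open>i + 1\<close> to the crossing of these two strands.  A permutation is sent to the
  diagram of any of its expressions as a product of adjacent transpositions; by the Coxeter
  presentation of \<open>S\<^sub>r\<close> the choice is immaterial.\<close>

definition strand_crossing :: "nat \<Rightarrow> nat \<Rightarrow> 'k::field mor" where
  "strand_crossing r i = tens (idm (replicate i Up)) (tens crossing (idm (replicate (r - 2 - i) Up)))"

definition word_perm :: "nat list \<Rightarrow> nat \<Rightarrow> nat" where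
  "word_perm ws = foldr (\<lambda>i \<sigma>. Transposition.transpose i (Suc i) \<circ> \<sigma>) ws id"

definition word_mor :: "nat \<Rightarrow> nat list \<Rightarrow> 'k::field mor" where
  "word_mor r ws = foldr (\<lambda>i f. strand_crossing r i * f) ws (idm (replicate r Up))"

definition perm_mor :: "nat \<Rightarrow> (nat \<Rightarrow> nat) \<Rightarrow> 'k::field mor" where
  "perm_mor r \<sigma> = word_mor r (SOME ws. (\<forall>i \<in> set ws. Suc i < r) \<and> word_perm ws = \<sigma>)"

definition grpalg_mor :: "nat \<Rightarrow> 'k::field grpalg \<Rightarrow> 'k mor mat" where
  "grpalg_mor r x = single (\<Sum>\<sigma> | \<sigma> permutes {..<r}. scale (x \<sigma>) (perm_mor r \<sigma>))"

section \<open>The objects and idempotents of the statement\<close>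

definition h_idem :: "nat \<Rightarrow> 'k::field_char_0 mor mat" where
  "h_idem r = grpalg_mor r (complete_sym r)"

definition a_idem :: "nat \<Rightarrow> 'k::field_char_0 mor mat" where
  "a_idem r = grpalg_mor r (complete_antisym r)"

definition e_idem :: "nat list \<Rightarrow> 'k::field mor mat" where
  "e_idem \<mu> = grpalg_mor (sum_list \<mu>) (young_idempotent \<mu>)"

definition P_sym :: "nat \<Rightarrow> 'k::field_char_0 hobj" where
  "P_sym r = ([replicate r Up], h_idem r)"

definition P_alt :: "nat \<Rightarrow> 'k::field_char_0 hobj" where
  "P_alt r = ([replicate r Up], a_idem r)"

definition P_part :: "nat list \<Rightarrow> 'k::field hobj" where
  "P_part \<mu> = ([replicate (sum_list \<mu>) Up], e_idem \<mu>)"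

end

theory Submission
  imports Defs "HOL-Library.Poly_Mapping"
begin

text \<open>Everything happens in the image of \<open>k[S\<^sub>r]\<close>, \<open>r = n + m\<close>.  Put
  \<open>K = RA\<close>, with \<open>R\<close> the sum over the permutations of the first \<open>n\<close> strands and
  \<open>A\<close> the signed sum over those of the last \<open>m\<close>, and let \<open>Y = RC\<close>, \<open>Y' = R'C'\<close> be the
  Young symmetrizers of the two hooks.  Splitting off a coset representative in the row or column
  group and using that a symmetrizer and an antisymmetrizer sharing a transposition annihilate each
  other, one finds \<open>YKY\<close> and \<open>Y'KY'\<close> as multiples of \<open>Y\<close> and \<open>Y'\<close>,
  \<open>YKY' = Y'KY = 0\<close>, and, with \<open>X = K (0 n) K\<close>,
  \<open>KYK = n! m! (n! m! K - m X)\<close> and \<open>KY'K = n! (m - 1)! (n! m! K + n X)\<close>.  The scalars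
  of the Young idempotents are such that \<open>X\<close> cancels in (iii).\<close>

section \<open>Morphisms of the category of words\<close>

text \<open>A Young symmetrizer is a row factor times a column factor, so in general it absorbs
  \<open>R\<close> on the left only; multiplying by \<open>K\<close> on the right gives no multiple
  of \<open>Y\<close> or \<open>Y'\<close>, and each sandwich needs its own computation. The
  asymmetry of the two hooks is that the column of the first contains all \<open>m\<close> strands
  of \<open>A\<close>, the column of the second only \<open>m - 1\<close> of them: \<open>A\<close>
  contributes \<open>m!\<close> in \<open>YKY\<close> but \<open>(m - 1)!\<close> in
  \<open>Y'KY'\<close>, and the missing \<open>m\<close> is the scalar in \<open>iota_m1\<close>.
  The scalars of the Young idempotents are inverse hook products, \<open>(n + m) (n - 1)! m!\<close>
  and \<open>(n + m) n! (m - 1)!\<close>. Two obstacles lie outside this computation.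
  \<open>perm_mor\<close> chooses a word by \<open>SOME\<close>, so multiplicativity of the action
  on diagrams rests on the completeness of the Coxeter relations. Coefficient functions with
  \<open>gmult\<close> form no ring type, so the algebra is done in a genuine ring and carried over
  by \<open>emb\<close> and \<open>mor_of\<close>; the description of \<open>young_scalar\<close> by
  \<open>THE\<close> also requires the symmetrizer to be nonzero.\<close>

lemma scale_plus: "scale (c + d) f = scale c f + scale d f"
  by transfer (rule deq.Scale_plus)

lemma scale_add: "scale c (f + g) = scale c f + scale c g"
  by transfer (rule deq.Scale_Add)

lemma scale_scale [simp]: "scale c (scale d f) = scale (c * d) f"
  by transfer (rule deq.Scale_Scale)

lemma scale_one [simp]: "scale 1 f = f"
  by transfer (rule deq.Scale_one)

lemma scale_zero_left [simp]: "scale 0 f = 0"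
  using scale_plus[of 0 0 f] by simp

lemma scale_zero_right [simp]: "scale c 0 = 0"
  using scale_add[of c 0 0] by simp

lemma scale_sum: "scale c (sum f A) = (\<Sum>a\<in>A. scale c (f a))"
  by (induction A rule: infinite_finite_induct) (auto simp: scale_add)

lemma scale_sum_left: "scale (sum f A) x = (\<Sum>a\<in>A. scale (f a) x)"
  by (induction A rule: infinite_finite_induct) (auto simp: scale_plus)

lemma scale_times_left [simp]: "scale c f * g = scale c (f * g)"
  by transfer (rule deq.Comp_Scale_left)

lemma scale_times_right [simp]: "f * scale c g = scale c (f * g)"
  by transfer (rule deq.Comp_Scale_right)

lemma tens_add_left: "tens (f + g) h = tens f h + tens g h"
  by transfer (rule deq.Tens_Add_left)

lemma tens_add_right: "tens h (f + g) = tens h f + tens h g"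
  by transfer (rule deq.Tens_Add_right)

lemma tens_scale_left [simp]: "tens (scale c f) g = scale c (tens f g)"
  by transfer (rule deq.Tens_Scale_left)

lemma tens_scale_right [simp]: "tens f (scale c g) = scale c (tens f g)"
  by transfer (rule deq.Tens_Scale_right)

lemma tens_sum_left: "tens (sum f A) g = (\<Sum>a\<in>A. tens (f a) g)"
proof (induction A rule: infinite_finite_induct)
  case empty
  show ?case using tens_add_left[of 0 0 g] by simp
qed (use tens_add_left[of 0 0 g] in \<open>auto simp: tens_add_left\<close>)

lemma tens_sum_right: "tens f (sum g A) = (\<Sum>a\<in>A. tens f (g a))"
proof (induction A rule: infinite_finite_induct)
  case empty
  show ?case using tens_add_right[of f 0 0] by simp
qed (use tens_add_right[of f 0 0] in \<open>auto simp: tens_add_right\<close>)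

lemma tens_assoc: "tens (tens f g) h = tens f (tens g h)"
  by transfer (rule deq.Tens_assoc)

lemma tens_idm [simp]: "tens (idm X) (idm Y) = idm (X @ Y)"
  by transfer (rule deq.Tens_Id)

lemma tens_unit_left [simp]: "tens (idm []) f = f"
  by transfer (rule deq.Tens_unit_left)

lemma tens_unit_right [simp]: "tens f (idm []) = f"
  by transfer (rule deq.Tens_unit_right)

section \<open>Morphism spaces between words\<close>

lemma whomE:
  assumes "f \<in> whom X Y"
  obtains t where "f = abs_mor t" "typed t X Y"
  using assms by (auto simp: whom_def)

lemma whomI: "typed t X Y \<Longrightarrow> abs_mor t \<in> whom X Y"
  by (auto simp: whom_def)

lemma idm_whom [simp]: "idm X \<in> whom X X"
  unfolding idm.abs_eq by (rule whomI) (rule typed.intros)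

lemma crossing_whom [simp]: "crossing \<in> whom [Up, Up] [Up, Up]"
  unfolding crossing.abs_eq by (rule whomI) (rule typed.intros)

lemma zero_whom [simp]: "0 \<in> whom X Y"
  unfolding zero_mor.abs_eq by (rule whomI) (rule typed.intros)

lemma times_whom: "f \<in> whom X Y \<Longrightarrow> g \<in> whom Y Z \<Longrightarrow> g * f \<in> whom X Z"
  by (elim whomE) (auto simp: times_mor.abs_eq intro!: whomI typed.intros)

lemma plus_whom: "f \<in> whom X Y \<Longrightarrow> g \<in> whom X Y \<Longrightarrow> f + g \<in> whom X Y"
  by (elim whomE) (auto simp: plus_mor.abs_eq intro!: whomI typed.intros)

lemma scale_whom: "f \<in> whom X Y \<Longrightarrow> scale c f \<in> whom X Y"
  by (elim whomE) (auto simp: scale.abs_eq intro!: whomI typed.intros)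

lemma tens_whom:
  "f \<in> whom X Y \<Longrightarrow> g \<in> whom X' Y' \<Longrightarrow> tens f g \<in> whom (X @ X') (Y @ Y')"
  by (elim whomE) (auto simp: tens.abs_eq intro!: whomI typed.intros)

lemma sum_whom: "(\<And>a. a \<in> A \<Longrightarrow> f a \<in> whom X Y) \<Longrightarrow> sum f A \<in> whom X Y"
  by (induction A rule: infinite_finite_induct) (auto intro: plus_whom)

lemma idm_times: "f \<in> whom X Y \<Longrightarrow> idm Y * f = f"
  by (elim whomE)
    (auto simp: times_mor.abs_eq idm.abs_eq mor.abs_eq_iff intro: deq.Comp_Id_left)

lemma times_idm: "f \<in> whom X Y \<Longrightarrow> f * idm X = f"
  by (elim whomE)
    (auto simp: times_mor.abs_eq idm.abs_eq mor.abs_eq_iff intro: deq.Comp_Id_right)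

lemma idm_idem [simp]: "idm X * idm X = idm X"
  by (rule idm_times) (rule idm_whom)

lemma tens_interchange:
  assumes "f \<in> whom X Y" "g \<in> whom Y Z" "f' \<in> whom X' Y'" "g' \<in> whom Y' Z'"
  shows "tens g g' * tens f f' = tens (g * f) (g' * f')"
  using assms
  by (elim whomE) (auto simp: times_mor.abs_eq tens.abs_eq mor.abs_eq_iff intro: deq.interchange)

lemma crossing_square: "crossing * crossing = idm [Up, Up]"
  by transfer (rule deq.double_crossing)

lemma crossing_braid:
  "tens crossing (idm [Up]) * tens (idm [Up]) crossing * tens crossing (idm [Up]) =
   tens (idm [Up]) crossing * tens crossing (idm [Up]) * tens (idm [Up]) crossing"
  by transfer (rule deq.braid)

section \<open>Relations among crossings of adjacent strands\<close>

abbreviation ups :: "nat \<Rightarrow> word" where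
  "ups r \<equiv> replicate r Up"

lemma ups_add: "ups (a + b) = ups a @ ups b"
  by (rule replicate_add)

lemma strand_crossing_eq:
  "strand_crossing (i + (2 + k)) i = tens (idm (ups i)) (tens crossing (idm (ups k)))"
  by (simp add: strand_crossing_def)

lemma ups_two: "ups 2 = [Up, Up]"
  by (simp add: numeral_2_eq_2)

lemma tens_endo:
  assumes "f \<in> whom X X" "g \<in> whom X X" "f' \<in> whom Y Y" "g' \<in> whom Y Y"
  shows "tens f f' * tens g g' = tens (f * g) (f' * g')"
  using assms by (intro tens_interchange)

lemma crossing_idm_whom: "tens crossing (idm X) \<in> whom (Up # Up # X) (Up # Up # X)"
  using tens_whom[OF crossing_whom idm_whom[of X]] by simp

lemma strand_crossing_whom:
  assumes "Suc i < r"
  shows "strand_crossing r i \<in> whom (ups r) (ups r)"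
proof -
  have "\<exists>k. r = i + (2 + k)" using assms by presburger
  then obtain k where r: "r = i + (2 + k)" ..
  show ?thesis
    unfolding r strand_crossing_eq unfolding ups_add ups_two
    by (intro tens_whom idm_whom crossing_whom)
qed

lemma strand_crossing_square:
  assumes "Suc i < r"
  shows "strand_crossing r i * strand_crossing r i = idm (ups r)"
proof -
  have "\<exists>k. r = i + (2 + k)" using assms by presburger
  then obtain k where r: "r = i + (2 + k)" ..
  show ?thesis
    unfolding r strand_crossing_eq
    by (simp add: tens_endo[OF idm_whom idm_whom crossing_idm_whom crossing_idm_whom]
      tens_endo[OF crossing_whom crossing_whom idm_whom idm_whom] crossing_square ups_two
      ups_add replicate_app_Cons_same)
qed

text \<open>An instance of the interchange law. Blocks of widths \<open>2 + k\<close> and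
  \<open>2 + l\<close> to the right of position \<open>i\<close> place the two crossings in
  different tensor factors.\<close>

lemma strand_crossing_commute:
  assumes "Suc i < j" "Suc j < r"
  shows "strand_crossing r i * strand_crossing r j = (strand_crossing r j * strand_crossing r i :: 'k::field mor)"
proof -
  define k l where "k = j - i - 2" and "l = r - 2 - j"
  have r: "r = i + (2 + (k + (2 + l)))" and j: "j = i + (2 + k)" and r': "r = j + (2 + l)"
    using assms by (auto simp: k_def l_def)
  let ?a = "tens crossing (idm (ups k)) :: 'k mor" and ?b = "tens crossing (idm (ups l)) :: 'k mor"
  let ?I = "\<lambda>k. idm (Up # Up # ups k) :: 'k mor"
  have i: "strand_crossing r i = tens (idm (ups i)) (tens ?a (?I l))"
    unfolding r strand_crossing_eq unfolding ups_add by (simp add: tens_assoc ups_two)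
  have "idm (ups j) = tens (idm (ups i)) (?I k)"
    unfolding j ups_add by (simp add: ups_two)
  then have j: "strand_crossing r j = tens (idm (ups i)) (tens (?I k) ?b)"
    unfolding r' strand_crossing_eq by (simp only: tens_assoc)
  note w = crossing_idm_whom[of "ups k"] crossing_idm_whom[of "ups l"]
  show ?thesis
    unfolding i j
    by (simp add: tens_endo[OF idm_whom idm_whom tens_whom tens_whom, OF w(1) idm_whom idm_whom w(2)]
      tens_endo[OF idm_whom idm_whom tens_whom tens_whom, OF idm_whom w(2) w(1) idm_whom]
      tens_endo[OF w(1) idm_whom idm_whom w(2)] tens_endo[OF idm_whom w(1) w(2) idm_whom]
      idm_times[OF w(1)] times_idm[OF w(1)] idm_times[OF w(2)] times_idm[OF w(2)])
qed

lemma strand_crossing_braid: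
  assumes "Suc (Suc i) < r"
  shows "strand_crossing r i * strand_crossing r (Suc i) * strand_crossing r i =
    strand_crossing r (Suc i) * strand_crossing r i * (strand_crossing r (Suc i) :: 'k::field mor)"
proof -
  have "\<exists>k. r = i + (3 + k)" using assms by presburger
  then obtain k where "r = i + (3 + k)" ..
  then have r: "r = i + (2 + (1 + k))" "r = (i + 1) + (2 + k)" by auto
  define a b :: "'k mor"
    where "a = tens crossing (idm [Up])" and "b = tens (idm [Up]) crossing"
  define U where "U = [Up, Up, Up]"
  have ab: "a \<in> whom U U" "b \<in> whom U U"
    unfolding a_def b_def U_def
    using tens_whom[OF crossing_whom idm_whom[of "[Up]"]] tens_whom[OF idm_whom[of "[Up]"] crossing_whom]
    by auto
  have i: "strand_crossing r i = tens (idm (ups i)) (tens a (idm (ups k)))"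
    unfolding r(1) strand_crossing_eq unfolding ups_add a_def by (simp add: tens_assoc)
  have "strand_crossing r (i + 1) = tens (tens (idm (ups i)) (idm [Up])) (tens crossing (idm (ups k)))"
    unfolding r(2) strand_crossing_eq unfolding ups_add by simp
  then have j: "strand_crossing r (Suc i) = tens (idm (ups i)) (tens b (idm (ups k)))"
    by (simp only: tens_assoc b_def Suc_eq_plus1)
  have mult: "tens (idm (ups i)) (tens x (idm (ups k))) * tens (idm (ups i)) (tens y (idm (ups k)))
      = tens (idm (ups i)) (tens (x * y) (idm (ups k)))"
    if "x \<in> whom U U" "y \<in> whom U U" for x y :: "'k mor"
    by (simp add: tens_endo[OF idm_whom idm_whom tens_whom tens_whom, OF that(1) idm_whom that(2) idm_whom]
      tens_endo[OF that idm_whom idm_whom])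
  have "a * b * a = b * a * b"
    unfolding a_def b_def by (rule crossing_braid)
  then show ?thesis
    unfolding i j by (simp add: mult ab times_whom[of _ U U])
qed

section \<open>The Coxeter presentation\<close>

text \<open>A reduction relation without symmetry: reversing \<open>square\<close> could insert a
  letter that names no crossing on \<open>r\<close> strands. In these directions no new letter ever
  appears, so validity of a word survives each step, and they suffice to reach the normal
  form.\<close>

inductive cox :: "nat list \<Rightarrow> nat list \<Rightarrow> bool" where
  refl: "cox ws ws"
| trans: "cox us vs \<Longrightarrow> cox vs ws \<Longrightarrow> cox us ws"
| square: "cox (us @ [i, i] @ vs) (us @ vs)"
| commute: "Suc i < j \<or> Suc j < i \<Longrightarrow> cox (us @ [i, j] @ vs) (us @ [j, i] @ vs)"
| braid: "cox (us @ [Suc i, i, Suc i] @ vs) (us @ [i, Suc i, i] @ vs)"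

lemma cox_append: "cox us vs \<Longrightarrow> cox (xs @ us @ ys) (xs @ vs @ ys)"
proof (induction rule: cox.induct)
  case (trans us vs ws)
  then show ?case by (blast intro: cox.trans)
next
  case (square us i vs)
  then show ?case using cox.square[of "xs @ us" i "vs @ ys"] by simp
next
  case (commute i j us vs)
  then show ?case using cox.commute[of i j "xs @ us" "vs @ ys"] by simp
next
  case (braid us i vs)
  then show ?case using cox.braid[of "xs @ us" i "vs @ ys"] by simp
qed (rule cox.refl)

lemma cox_set: "cox us vs \<Longrightarrow> set vs \<subseteq> set us"
  by (induction rule: cox.induct) auto

lemma cox_commute_block:
  assumes "\<And>j. j \<in> set ws \<Longrightarrow> Suc i < j \<or> Suc j < i"
  shows "cox (i # ws) (ws @ [i])"
  using assms
proof (induction ws)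
  case Nil
  show ?case by (simp add: cox.refl)
next
  case (Cons j ws)
  have "cox (i # j # ws) (j # i # ws)"
    using cox.commute[of i j "[]" ws] Cons.prems by auto
  moreover have "cox (j # i # ws) (j # ws @ [i])"
    using cox_append[OF Cons.IH, of "[j]" "[]"] Cons.prems by auto
  ultimately show ?case by (auto intro: cox.trans)
qed

text \<open>\<open>[p..<r]\<close> is the cycle carrying \<open>r\<close> to \<open>p\<close>, a
  representative of a left coset of the stabilizer of \<open>r\<close>. A letter put in front
  shortens it, lengthens it, commutes past it, or, for \<open>i > p\<close>, passes through by a
  braid move and comes out as \<open>i - 1\<close>. Whatever comes out is below \<open>r - 1\<close>
  and hence fixes \<open>r\<close>.\<close>

lemma cox_Cons_block:
  assumes "i < r" "p \<le> r"
  shows "\<exists>q vs. q \<le> r \<and> set vs \<subseteq> {..<r - 1} \<and> cox (i # [p..<r]) ([q..<r] @ vs)"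
proof -
  consider "i = p" | "Suc i = p" | "Suc i < p" | "p < i" by linarith
  then show ?thesis
  proof cases
    case 1
    then show ?thesis
      using assms cox.square[of "[]" p "[Suc p..<r]"]
      by (intro exI[of _ "Suc p"] exI[of _ "[]"]) (auto simp: upt_conv_Cons)
  next
    case 2
    then show ?thesis
      using assms by (intro exI[of _ i] exI[of _ "[]"]) (auto simp: upt_conv_Cons cox.refl)
  next
    case 3
    then show ?thesis
      using assms cox_commute_block[of "[p..<r]" i]
      by (intro exI[of _ p] exI[of _ "[i]"]) auto
  next
    case 4
    then obtain k where i: "i = Suc k" and pk: "p \<le> k" by (cases i) auto
    have eq: "[p..<r] = [p..<k] @ [k, i] @ [Suc i..<r]"
      using assms pk upt_add_eq_append[of p k "r - k"] by (simp add: i upt_conv_Cons)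
    have "cox (i # [p..<k]) ([p..<k] @ [i])"
      by (rule cox_commute_block) (auto simp: i)
    from cox_append[OF this, of "[]" "[k, i] @ [Suc i..<r]"]
    have "cox (i # [p..<r]) ([p..<k] @ [i, k, i] @ [Suc i..<r])" by (simp add: eq)
    moreover have "cox \<dots> ([p..<k] @ [k, i, k] @ [Suc i..<r])"
      unfolding i by (rule cox.braid)
    moreover have "cox (k # [Suc i..<r]) ([Suc i..<r] @ [k])"
      by (rule cox_commute_block) (auto simp: i)
    from cox_append[OF this, of "[p..<k] @ [k, i]" "[]"]
    have "cox ([p..<k] @ [k, i, k] @ [Suc i..<r]) ([p..<r] @ [k])" by (simp add: eq)
    ultimately have "cox (i # [p..<r]) ([p..<r] @ [k])" by (blast intro: cox.trans)
    then show ?thesis using assms i by (intro exI[of _ p] exI[of _ "[k]"]) auto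
  qed
qed

lemma cox_normal_form:
  assumes "set ws \<subseteq> {..<r}"
  shows "\<exists>p vs. p \<le> r \<and> set vs \<subseteq> {..<r - 1} \<and> cox ws ([p..<r] @ vs)"
  using assms
proof (induction ws)
  case Nil
  show ?case by (intro exI[of _ r] exI[of _ "[]"]) (auto simp: cox.refl)
next
  case (Cons i ws)
  then obtain p vs where p: "p \<le> r" "set vs \<subseteq> {..<r - 1}" "cox ws ([p..<r] @ vs)" by auto
  obtain q us where q: "q \<le> r" "set us \<subseteq> {..<r - 1}" "cox (i # [p..<r]) ([q..<r] @ us)"
    using cox_Cons_block[of i r p] Cons.prems p by auto
  have "cox (i # ws) (i # [p..<r] @ vs)" using cox_append[OF p(3), of "[i]" "[]"] by simp
  moreover have "cox (i # [p..<r] @ vs) ([q..<r] @ us @ vs)"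
    using cox_append[OF q(3), of "[]" vs] by simp
  ultimately show ?case
    using p q by (intro exI[of _ q] exI[of _ "us @ vs"]) (auto intro: cox.trans)
qed

section \<open>Words as permutations and as diagrams\<close>

lemma word_perm_Nil [simp]: "word_perm [] = id"
  by (simp add: word_perm_def)

lemma word_perm_Cons [simp]:
  "word_perm (i # ws) = Transposition.transpose i (Suc i) \<circ> word_perm ws"
  by (simp add: word_perm_def)

lemma word_perm_append [simp]: "word_perm (us @ vs) = word_perm us \<circ> word_perm vs"
  by (induction us) (auto simp: o_assoc)

lemma bij_word_perm [simp]: "bij (word_perm ws)"
  by (induction ws) (simp_all only: word_perm_Nil word_perm_Cons bij_id bij_comp bij_transpose)

lemma cox_word_perm: "cox us vs \<Longrightarrow> word_perm us = word_perm vs"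
proof (induction rule: cox.induct)
  case (commute i j us vs)
  then show ?case
    by (auto simp: fun_eq_iff Transposition.transpose_def)
next
  case (braid us i vs)
  have "Transposition.transpose (Suc i) (Suc (Suc i)) \<circ> (Transposition.transpose i (Suc i) \<circ>
      (Transposition.transpose (Suc i) (Suc (Suc i)) \<circ> f)) =
    Transposition.transpose i (Suc i) \<circ> (Transposition.transpose (Suc i) (Suc (Suc i)) \<circ>
      (Transposition.transpose i (Suc i) \<circ> f))" for f :: "nat \<Rightarrow> nat"
    by (auto simp: fun_eq_iff Transposition.transpose_def)
  then show ?case by (simp add: o_assoc[symmetric])
next
  case (square us i vs)
  have "Transposition.transpose i (Suc i) \<circ> (Transposition.transpose i (Suc i) \<circ> f) = f"
    for f :: "nat \<Rightarrow> nat"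
    by (simp add: fun_eq_iff)
  then show ?case by simp
qed simp_all

lemma word_perm_permutes: "set ws \<subseteq> {..<r} \<Longrightarrow> word_perm ws permutes {..r}"
  by (induction ws) (auto intro!: permutes_compose permutes_swap_id permutes_id)

lemma word_perm_upt: "p \<le> r \<Longrightarrow> word_perm [p..<r] r = p"
proof (induction "r - p" arbitrary: p)
  case (Suc k)
  then have "[p..<r] = p # [Suc p..<r]" "word_perm [Suc p..<r] r = Suc p"
    by (auto simp: upt_conv_Cons)
  then show ?case by simp
qed auto

text \<open>The tail fixes \<open>r\<close>, so the permutation determines the leading block; this
  makes the normal form unique.\<close>

lemma word_perm_normal_form:
  assumes "p \<le> r" "set vs \<subseteq> {..<r - 1}"
  shows "word_perm ([p..<r] @ vs) r = p"
proof (cases r)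
  case (Suc r')
  then have "word_perm vs r = r"
    using word_perm_permutes[of vs r'] assms by (auto simp: permutes_def)
  then show ?thesis using word_perm_upt[OF assms(1)] by simp
qed (use assms in auto)

lemma word_mor_Nil [simp]: "word_mor r [] = idm (ups r)"
  by (simp add: word_mor_def)

lemma word_mor_Cons [simp]: "word_mor r (i # ws) = strand_crossing r i * word_mor r ws"
  by (simp add: word_mor_def)

abbreviation word_on :: "nat \<Rightarrow> nat list \<Rightarrow> bool" where
  "word_on r ws \<equiv> \<forall>i \<in> set ws. Suc i < r"

lemma word_mor_whom: "word_on r ws \<Longrightarrow> word_mor r ws \<in> whom (ups r) (ups r)"
  by (induction ws) (auto intro: times_whom strand_crossing_whom)

lemma word_mor_append:
  "word_on r us \<Longrightarrow> word_on r vs \<Longrightarrow> word_mor r (us @ vs) = word_mor r us * word_mor r vs"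
  by (induction us) (auto simp: mult.assoc idm_times[OF word_mor_whom])

lemma cox_word_mor:
  "cox us vs \<Longrightarrow> word_on r us \<Longrightarrow> (word_mor r us :: 'k::field mor) = word_mor r vs"
proof (induction rule: cox.induct)
  case (trans us vs ws)
  then show ?case using cox_set by (metis subset_iff)
next
  case (square us i vs)
  then show ?case
    by (simp add: word_mor_append idm_times[OF word_mor_whom] strand_crossing_square flip: mult.assoc)
next
  case (commute i j us vs)
  have "strand_crossing r i * strand_crossing r j = (strand_crossing r j * strand_crossing r i :: 'k mor)"
    using commute strand_crossing_commute by auto
  then show ?case
    using commute.prems by (simp add: word_mor_append) (simp flip: mult.assoc)
next
  case (braid us i vs)
  have "strand_crossing r (Suc i) * strand_crossing r i * strand_crossing r (Suc i) =
    (strand_crossing r i * strand_crossing r (Suc i) * strand_crossing r i :: 'k mor)"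
    using braid.prems by (intro strand_crossing_braid[symmetric]) auto
  then show ?case
    using braid.prems by (simp add: word_mor_append) (auto simp flip: mult.assoc)
qed auto

text \<open>Induction along the chain of symmetric groups: equal permutations have equal leading
  blocks, and cancelling these leaves words in one generator fewer. The bound \<open>s\<close> on
  the letters is separate from \<open>r\<close> because the diagrams keep all \<open>r\<close>
  strands throughout.\<close>

lemma word_mor_unique:
  assumes "set us \<subseteq> {..<s}" "set vs \<subseteq> {..<s}" "s < r" "word_perm us = word_perm vs"
  shows "(word_mor r us :: 'k::field mor) = word_mor r vs"
  using assms
proof (induction s arbitrary: us vs)
  case 0
  then show ?case by simp
next
  case (Suc s)
  obtain p us' where us: "p \<le> Suc s" "set us' \<subseteq> {..<s}" "cox us ([p..<Suc s] @ us')"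
    using cox_normal_form[OF Suc.prems(1)] by auto
  obtain q vs' where vs: "q \<le> Suc s" "set vs' \<subseteq> {..<s}" "cox vs ([q..<Suc s] @ vs')"
    using cox_normal_form[OF Suc.prems(2)] by auto
  have eq: "word_perm ([p..<Suc s] @ us') = word_perm ([q..<Suc s] @ vs')"
    using us vs Suc.prems cox_word_perm by metis
  then have "p = q"
    using word_perm_normal_form[of p "Suc s" us'] word_perm_normal_form[of q "Suc s" vs'] us vs
    by (simp del: upt_Suc)
  have "word_perm us' = word_perm vs'"
    using eq bij_word_perm[of "[p..<Suc s]"] unfolding \<open>p = q\<close> word_perm_append
    by (metis bij_is_inj fun.inj_map injD)
  then have "word_mor r us' = (word_mor r vs' :: 'k mor)"
    using us vs Suc.prems(3) by (intro Suc.IH) auto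
  moreover have "word_on r [p..<Suc s]" "word_on r us'" "word_on r vs'" "word_on r us" "word_on r vs"
    using Suc.prems us vs by auto
  ultimately have "word_mor r ([p..<Suc s] @ us') = (word_mor r ([q..<Suc s] @ vs') :: 'k mor)"
    unfolding \<open>p = q\<close> by (simp only: word_mor_append)
  then show ?case
    using cox_word_mor[OF us(3) \<open>word_on r us\<close>, where 'k = 'k]
      cox_word_mor[OF vs(3) \<open>word_on r vs\<close>, where 'k = 'k] by simp
qed

text \<open>The cycle \<open>c\<close> carries \<open>r\<close> to its image under
  \<open>\<sigma>\<close>, so dividing by \<open>c\<close> leaves a permutation that fixes
  \<open>r\<close>.\<close>

lemma word_perm_surj:
  assumes "\<sigma> permutes {..<r}"
  shows "\<exists>ws. word_on r ws \<and> word_perm ws = \<sigma>"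
  using assms
proof (induction r arbitrary: \<sigma>)
  case 0
  then show ?case by (intro exI[of _ "[]"]) auto
next
  case (Suc r)
  define p where "p = \<sigma> r"
  have p: "p \<le> r" using permutes_in_image[OF Suc.prems, of r] by (auto simp: p_def)
  define c where "c = word_perm [p..<r]"
  have c: "c permutes {..<Suc r}"
    using word_perm_permutes[of "[p..<r]" r] by (simp add: c_def lessThan_Suc_atMost subset_iff)
  have perm: "inv_into UNIV c \<circ> \<sigma> permutes {..<Suc r}" using c Suc.prems by (intro permutes_compose permutes_inv)
  have fix_r: "(inv_into UNIV c \<circ> \<sigma>) r = r"
    using word_perm_upt[OF p] permutes_inv_eq[OF c] by (simp add: c_def p_def)
  have "inv_into UNIV c \<circ> \<sigma> permutes {..<r}"
    by (rule permutes_superset[OF perm]) (use fix_r in \<open>auto simp only: less_Suc_eq lessThan_iff Diff_iff\<close>)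
  from Suc.IH[OF this] obtain ws where ws: "word_on r ws" "word_perm ws = inv_into UNIV c \<circ> \<sigma>" by blast
  have "word_perm ([p..<r] @ ws) = \<sigma>"
    unfolding word_perm_append ws c_def[symmetric] o_assoc permutes_inv_o(1)[OF c] by (rule id_o)
  then show ?case using ws p by (intro exI[of _ "[p..<r] @ ws"]) auto
qed

text \<open>Frees \<open>perm_mor\<close> from its arbitrary choice, so that composition of
  permutations can be read off from concatenation of words.\<close>

lemma perm_mor_word_perm:
  assumes "word_on r ws"
  shows "(perm_mor r (word_perm ws) :: 'k::field mor) = word_mor r ws"
proof -
  define vs where "vs = (SOME vs. word_on r vs \<and> word_perm vs = word_perm ws)"
  have vs: "word_on r vs" "word_perm vs = word_perm ws"
    using someI_ex[of "\<lambda>vs. word_on r vs \<and> word_perm vs = word_perm ws"] assms by (auto simp: vs_def)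
  have "(perm_mor r (word_perm ws) :: 'k mor) = word_mor r vs"
    by (simp only: perm_mor_def vs_def)
  moreover have "word_mor r vs = (word_mor r ws :: 'k mor)"
  proof (cases r)
    case 0
    then have "vs = []" "ws = []" using assms vs by (cases vs; cases ws; auto)+
    then show ?thesis by simp
  next
    case (Suc s)
    then show ?thesis
      using vs assms by (intro word_mor_unique[of _ s]) auto
  qed
  ultimately show ?thesis by simp
qed

lemma perm_mor_compose:
  assumes "\<sigma> permutes {..<r}" "\<tau> permutes {..<r}"
  shows "perm_mor r (\<sigma> \<circ> \<tau>) = perm_mor r \<sigma> * perm_mor r \<tau>"
proof -
  obtain us vs where "word_on r us" "word_perm us = \<sigma>" "word_on r vs" "word_perm vs = \<tau>"
    using assms word_perm_surj by metis
  then have "word_on r us" "word_on r vs" "word_on r (us @ vs)" "\<sigma> \<circ> \<tau> = word_perm (us @ vs)"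
    "\<sigma> = word_perm us" "\<tau> = word_perm vs" by auto
  then show ?thesis by (simp only: perm_mor_word_perm word_mor_append)
qed

lemma perm_mor_whom: "\<sigma> permutes {..<r} \<Longrightarrow> perm_mor r \<sigma> \<in> whom (ups r) (ups r)"
  using word_perm_surj[of \<sigma> r] by (auto simp: perm_mor_word_perm intro: word_mor_whom)

section \<open>Juxtaposition of permutation diagrams\<close>

lemma strand_crossing_tens_left:
  assumes "Suc i < n"
  shows "strand_crossing (n + m) i = tens (strand_crossing n i) (idm (ups m))"
proof -
  have "n + m - 2 - i = (n - 2 - i) + m" using assms by simp
  then show ?thesis by (simp add: strand_crossing_def tens_assoc ups_add)
qed

lemma strand_crossing_tens_right:
  "strand_crossing (n + m) (n + i) = tens (idm (ups n)) (strand_crossing m i)"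
proof -
  have "n + m - 2 - (n + i) = m - 2 - i" by simp
  then show ?thesis unfolding strand_crossing_def ups_add by (simp add: tens_assoc flip: tens_idm)
qed

lemma word_mor_tens_left:
  "word_on n us \<Longrightarrow> word_mor (n + m) us = tens (word_mor n us) (idm (ups m))"
proof (induction us)
  case (Cons i us)
  then show ?case
    by (simp add: strand_crossing_tens_left)
      (subst tens_interchange[OF word_mor_whom strand_crossing_whom idm_whom idm_whom]; simp)
qed (simp add: ups_add)

lemma word_mor_tens_right:
  "word_on m vs \<Longrightarrow> word_mor (n + m) (map ((+) n) vs) = tens (idm (ups n)) (word_mor m vs)"
proof (induction vs)
  case (Cons i vs)
  then show ?case
    by (simp add: strand_crossing_tens_right)
      (subst tens_interchange[OF idm_whom idm_whom word_mor_whom strand_crossing_whom]; simp)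
qed (simp add: ups_add)

text \<open>The permutation belonging to \<open>n\<close> identity strands followed by the diagram
  of \<open>\<sigma>\<close>.\<close>

definition shift_perm :: "nat \<Rightarrow> (nat \<Rightarrow> nat) \<Rightarrow> nat \<Rightarrow> nat" where
  "shift_perm n \<sigma> i = (if i < n then i else n + \<sigma> (i - n))"

lemma word_perm_shift: "word_perm (map ((+) n) vs) = shift_perm n (word_perm vs)"
proof (induction vs)
  case (Cons i vs)
  then show ?case by (auto simp: fun_eq_iff shift_perm_def Transposition.transpose_def)
qed (auto simp: fun_eq_iff shift_perm_def)

text \<open>Interchange turns a juxtaposition into a vertical stack of two diagrams padded by
  identity strands, and padding on the left only shifts the letters of a word.\<close>

lemma tens_perm_mor:
  assumes "\<sigma> permutes {..<n}" "\<tau> permutes {..<m}"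
  shows "tens (perm_mor n \<sigma>) (perm_mor m \<tau>) =
    (perm_mor (n + m) (\<sigma> \<circ> shift_perm n \<tau>) :: 'k::field mor)"
proof -
  obtain us vs where w: "word_on n us" "word_perm us = \<sigma>" "word_on m vs" "word_perm vs = \<tau>"
    using assms word_perm_surj by metis
  define vs' where "vs' = map ((+) n) vs"
  have w': "word_on (n + m) us" "word_on (n + m) vs'" using w by (auto simp: vs'_def)
  have "perm_mor (n + m) (\<sigma> \<circ> shift_perm n \<tau>) =
      (perm_mor (n + m) (word_perm (us @ vs')) :: 'k mor)"
    using w by (simp add: vs'_def word_perm_shift)
  also have "\<dots> = word_mor (n + m) us * word_mor (n + m) vs'"
    using w' by (subst perm_mor_word_perm) (auto simp: word_mor_append)
  also have "\<dots> = tens (word_mor n us) (idm (ups m)) * tens (idm (ups n)) (word_mor m vs)"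
    using w by (simp add: word_mor_tens_left word_mor_tens_right vs'_def)
  also have "\<dots> = tens (word_mor n us) (word_mor m vs)"
    using w by (subst tens_interchange[OF idm_whom word_mor_whom word_mor_whom idm_whom])
      (auto simp: idm_times[OF word_mor_whom] times_idm[OF word_mor_whom])
  also have "\<dots> = tens (perm_mor n \<sigma>) (perm_mor m \<tau>)"
    by (simp only: perm_mor_word_perm[OF w(1), unfolded w(2)] perm_mor_word_perm[OF w(3), unfolded w(4)])
  finally show ?thesis by (rule HOL.sym)
qed

section \<open>Symmetrizers and antisymmetrizers\<close>

text \<open>Group algebras of symmetric groups of all ranks live in the monoid algebra of the
  self-maps of \<open>nat\<close>; the wrapper type makes composition the addition that
  \<open>poly_mapping\<close> expects of its keys.\<close>

datatype endo = Endo (app: "nat \<Rightarrow> nat")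

instantiation endo :: monoid_add
begin

definition "0 = Endo id"
definition "x + y = Endo (app x \<circ> app y)"

instance
  by standard (simp_all add: zero_endo_def plus_endo_def o_assoc)

end

type_synonym 'k alg = "endo \<Rightarrow>\<^sub>0 'k"

text \<open>Scalars are realized as multiples of the unit, so their laws are ring laws; only
  centrality needs an argument, the ring being noncommutative.\<close>

definition scl :: "'k::comm_ring_1 \<Rightarrow> 'k alg \<Rightarrow> 'k alg" where
  "scl c x = Poly_Mapping.single 0 c * x"

lemma single_zero_central:
  fixes x :: "'k::comm_ring_1 alg"
  shows "Poly_Mapping.single 0 c * x = x * Poly_Mapping.single 0 c"
proof (induction x rule: update_induct)
  case (update f a b)
  have "Poly_Mapping.update a b f = f + Poly_Mapping.single a b"
    using update(1)
    by (intro poly_mapping_eqI)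
      (auto simp: lookup_update lookup_add lookup_single in_keys_iff)
  then show ?case
    using update(3) by (simp add: distrib_left distrib_right mult_single mult.commute)
qed simp

lemma scl_mult_left [simp]: "scl c x * y = scl c (x * y)"
  by (simp add: scl_def mult.assoc)

lemma scl_mult_right [simp]: "x * scl c y = scl c (x * y)"
  by (simp add: scl_def single_zero_central mult.assoc)

lemma scl_scl [simp]: "scl c (scl d x) = scl (c * d) x"
  by (simp add: scl_def mult_single flip: mult.assoc)

lemma scl_one [simp]: "scl 1 x = x"
  by (simp add: scl_def)

lemma scl_zero [simp]: "scl 0 x = 0" "scl c 0 = 0"
  by (simp_all add: scl_def)

lemma scl_add: "scl c (x + y) = scl c x + scl c y"
  by (simp add: scl_def distrib_left)

lemma scl_diff: "scl c (x - y) = scl c x - scl c y"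
  by (simp add: scl_def right_diff_distrib)

lemma scl_plus: "scl (c + d) x = scl c x + scl d x"
  by (simp add: scl_def single_add distrib_right)

lemma scl_uminus [simp]: "scl c (- x) = - scl c x"
  by (simp add: scl_def)

lemma scl_minus_one: "scl (- 1) x = - x"
  using scl_plus[of "- 1" 1 x] by (simp add: eq_neg_iff_add_eq_0)

lemma scl_sum: "scl c (sum f A) = (\<Sum>a\<in>A. scl c (f a))"
  by (simp add: scl_def sum_distrib_left)

lemma scl_sum_left: "scl (sum f A) x = (\<Sum>a\<in>A. scl (f a) x)"
  by (induction A rule: infinite_finite_induct) (auto simp: scl_plus)

lemma sum_const_scl: "(\<Sum>a\<in>A. x) = scl (of_nat (card A)) x"
  by (simp add: scl_def)

lemma lookup_scl: "Poly_Mapping.lookup (scl c x) k = c * Poly_Mapping.lookup x k"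
  by (simp add: scl_def flip: mult_map_scale_conv_mult) (simp add: Poly_Mapping.map.rep_eq when_def)

text \<open>Characteristic zero enters the vanishing arguments here: they exhibit an element equal
  to its own negative.\<close>

lemma eq_uminus_self_alg:
  fixes x :: "'k::field_char_0 alg"
  assumes "x = - x"
  shows "x = 0"
proof -
  from assms have "Poly_Mapping.lookup x k = - Poly_Mapping.lookup x k" for k
    by (metis lookup_uminus)
  then show "x = 0"
    by (intro poly_mapping_eqI) (simp add: equal_neg_zero)
qed

definition grp :: "(nat \<Rightarrow> nat) \<Rightarrow> 'k::comm_ring_1 alg" where
  "grp \<sigma> = Poly_Mapping.single (Endo \<sigma>) 1"

lemma grp_comp: "grp (\<sigma> \<circ> \<tau>) = grp \<sigma> * grp \<tau>"
  by (simp add: grp_def mult_single plus_endo_def)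

lemma grp_id [simp]: "grp id = 1"
  by (simp add: grp_def flip: zero_endo_def)

lemma lookup_grp: "Poly_Mapping.lookup (grp \<sigma>) (Endo \<tau>) = (if \<sigma> = \<tau> then 1 else 0)"
  by (simp add: grp_def lookup_single when_def)

text \<open>Taken over an arbitrary set of strands and left unnormalized: the row and column groups
  of both hooks then live in one algebra, and coset expansions have coefficients \<open>1\<close>
  and \<open>-1\<close>.\<close>

definition symm :: "nat set \<Rightarrow> 'k::comm_ring_1 alg" where
  "symm A = (\<Sum>\<sigma> | \<sigma> permutes A. grp \<sigma>)"

definition alt :: "nat set \<Rightarrow> 'k::comm_ring_1 alg" where
  "alt A = (\<Sum>\<sigma> | \<sigma> permutes A. scl (of_int (sign \<sigma>)) (grp \<sigma>))"

lemma grp_mult_symm: "\<pi> permutes A \<Longrightarrow> grp \<pi> * symm A = symm A"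
  unfolding symm_def sum_distrib_left grp_comp[symmetric]
  by (rule setum_permutations_compose_left[symmetric])

lemma symm_mult_grp: "\<pi> permutes A \<Longrightarrow> symm A * grp \<pi> = symm A"
  unfolding symm_def sum_distrib_right grp_comp[symmetric]
  by (rule sum_permutations_compose_right[symmetric])

lemma sign_compose_permutes:
  "finite A \<Longrightarrow> \<sigma> permutes A \<Longrightarrow> \<tau> permutes A \<Longrightarrow> sign (\<sigma> \<circ> \<tau>) = sign \<sigma> * sign \<tau>"
  by (intro sign_compose) (auto simp: permutation_permutes)

lemma of_int_sign_sign [simp]: "of_int (sign \<sigma>) * of_int (sign \<sigma>) = (1 :: 'k::comm_ring_1)"
  by (metis of_int_1 of_int_mult sign_idempotent)

lemma grp_mult_alt:
  assumes "finite A" "\<pi> permutes A"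
  shows "grp \<pi> * alt A = scl (of_int (sign \<pi>)) (alt A)"
proof -
  have "scl (of_int (sign \<pi>)) (alt A) =
      (\<Sum>\<sigma> | \<sigma> permutes A. scl (of_int (sign \<pi>)) (scl (of_int (sign (\<pi> \<circ> \<sigma>))) (grp (\<pi> \<circ> \<sigma>))))"
    unfolding alt_def scl_sum by (rule setum_permutations_compose_left[OF assms(2)])
  also have "\<dots> = grp \<pi> * alt A"
    unfolding alt_def sum_distrib_left
    by (rule sum.cong)
      (auto simp: grp_comp sign_compose_permutes[OF assms] simp flip: mult.assoc)
  finally show ?thesis by (rule HOL.sym)
qed

lemma alt_mult_grp:
  assumes "finite A" "\<pi> permutes A"
  shows "alt A * grp \<pi> = scl (of_int (sign \<pi>)) (alt A)"
proof -
  have "scl (of_int (sign \<pi>)) (alt A) =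
      (\<Sum>\<sigma> | \<sigma> permutes A. scl (of_int (sign \<pi>)) (scl (of_int (sign (\<sigma> \<circ> \<pi>))) (grp (\<sigma> \<circ> \<pi>))))"
    unfolding alt_def scl_sum by (rule sum_permutations_compose_right[OF assms(2)])
  also have "\<dots> = alt A * grp \<pi>"
    unfolding alt_def sum_distrib_right
    by (rule sum.cong)
      (auto simp: grp_comp sign_compose_permutes[OF assms(1) _ assms(2)] mult.left_commute)
  finally show ?thesis by (rule HOL.sym)
qed

lemma card_permutes: "finite A \<Longrightarrow> of_nat (card {\<sigma>. \<sigma> permutes A}) = fact (card A)"
  by (simp add: card_permutations)

lemma
  assumes "finite A" "B \<subseteq> A"
  shows symm_mult_symm_left: "symm B * symm A = (scl (fact (card B)) (symm A) :: 'k::field_char_0 alg)"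
    and symm_mult_symm_right: "symm A * symm B = (scl (fact (card B)) (symm A) :: 'k::field_char_0 alg)"
proof -
  have "finite B" using assms by (rule rev_finite_subset)
  have sub: "\<sigma> permutes A" if "\<sigma> permutes B" for \<sigma>
    using that assms(2) by (rule permutes_subset)
  show "symm B * symm A = (scl (fact (card B)) (symm A) :: 'k alg)"
    unfolding symm_def[of B] sum_distrib_right
    by (simp add: grp_mult_symm sub sum_const_scl card_permutes \<open>finite B\<close> del: sum_constant)
  show "symm A * symm B = (scl (fact (card B)) (symm A) :: 'k alg)"
    unfolding symm_def[of B] sum_distrib_left
    by (simp add: symm_mult_grp sub sum_const_scl card_permutes \<open>finite B\<close> del: sum_constant)
qed

lemma
  assumes "finite A" "B \<subseteq> A"
  shows alt_mult_alt_left: "alt B * alt A = (scl (fact (card B)) (alt A) :: 'k::field_char_0 alg)"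
    and alt_mult_alt_right: "alt A * alt B = (scl (fact (card B)) (alt A) :: 'k::field_char_0 alg)"
proof -
  have "finite B" using assms by (rule rev_finite_subset)
  have sub: "\<sigma> permutes A" if "\<sigma> permutes B" for \<sigma>
    using that assms(2) by (rule permutes_subset)
  show "alt B * alt A = (scl (fact (card B)) (alt A) :: 'k alg)"
    unfolding alt_def[of B] sum_distrib_right
    by (simp add: grp_mult_alt sub assms sum_const_scl card_permutes \<open>finite B\<close> del: sum_constant)
  show "alt A * alt B = (scl (fact (card B)) (alt A) :: 'k alg)"
    unfolding alt_def[of B] sum_distrib_left
    by (simp add: alt_mult_grp sub assms sum_const_scl card_permutes \<open>finite B\<close> del: sum_constant)
qed

lemma permutes_disjoint_commute:
  assumes "\<sigma> permutes A" "\<tau> permutes B" "A \<inter> B = {}"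
  shows "\<sigma> \<circ> \<tau> = \<tau> \<circ> \<sigma>"
proof
  fix x
  have "\<sigma> x \<in> A \<longleftrightarrow> x \<in> A" "\<tau> x \<in> B \<longleftrightarrow> x \<in> B" using assms permutes_in_image by metis+
  then show "(\<sigma> \<circ> \<tau>) x = (\<tau> \<circ> \<sigma>) x"
    using assms permutes_not_in[of \<sigma> A] permutes_not_in[of \<tau> B]
    by (cases "x \<in> A"; cases "x \<in> B") (auto simp: disjoint_iff)
qed

lemma symm_alt_commute:
  assumes "A \<inter> B = {}"
  shows "symm A * alt B = (alt B * symm A :: 'k::comm_ring_1 alg)"
proof -
  have "grp \<sigma> * grp \<tau> = (grp \<tau> * grp \<sigma> :: 'k alg)" if "\<sigma> permutes A" "\<tau> permutes B" for \<sigma> \<tau>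
    using permutes_disjoint_commute[OF that assms] by (metis grp_comp)
  then show ?thesis
    unfolding symm_def alt_def sum_product
    by (subst sum.swap) (auto intro!: sum.cong)
qed

section \<open>Transpositions next to symmetrizers and antisymmetrizers\<close>

definition tr :: "nat \<Rightarrow> nat \<Rightarrow> 'k::comm_ring_1 alg" where
  "tr a b = grp (Transposition.transpose a b)"

lemma tr_self [simp]: "tr a a = 1"
  by (simp add: tr_def)

lemma tr_commute: "tr a b = tr b a"
  by (simp add: tr_def Transposition.transpose_commute)

lemma tr_conj:
  assumes "a \<noteq> b" "c \<noteq> b"
  shows "tr a b * tr a c = tr a c * tr c b"
  using assms unfolding tr_def grp_comp[symmetric]
  by (intro arg_cong[of _ _ grp]) (auto simp: fun_eq_iff Transposition.transpose_def)

lemma tr_mult_symm: "a \<in> A \<Longrightarrow> b \<in> A \<Longrightarrow> tr a b * symm A = symm A"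
  unfolding tr_def by (intro grp_mult_symm permutes_swap_id)

lemma symm_mult_tr: "a \<in> A \<Longrightarrow> b \<in> A \<Longrightarrow> symm A * tr a b = symm A"
  unfolding tr_def by (intro symm_mult_grp permutes_swap_id)

lemma tr_mult_alt: "finite A \<Longrightarrow> a \<in> A \<Longrightarrow> b \<in> A \<Longrightarrow> a \<noteq> b \<Longrightarrow> tr a b * alt A = - alt A"
  unfolding tr_def by (simp add: grp_mult_alt permutes_swap_id sign_swap_id scl_minus_one)

lemma alt_mult_tr: "finite A \<Longrightarrow> a \<in> A \<Longrightarrow> b \<in> A \<Longrightarrow> a \<noteq> b \<Longrightarrow> alt A * tr a b = - alt A"
  unfolding tr_def by (simp add: alt_mult_grp permutes_swap_id sign_swap_id scl_minus_one)

text \<open>A shared transposition inserted between the factors acts as \<open>1\<close> on one and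
  as \<open>-1\<close> on the other.\<close>

lemma
  fixes a b :: nat and A B :: "nat set"
  assumes "finite B" "a \<in> A" "b \<in> A" "a \<in> B" "b \<in> B" "a \<noteq> b"
  shows symm_mult_alt_zero: "symm A * alt B = (0 :: 'k::field_char_0 alg)"
    and alt_mult_symm_zero: "alt B * symm A = (0 :: 'k::field_char_0 alg)"
proof -
  have "symm A * alt B = symm A * tr a b * (alt B :: 'k alg)"
    using assms by (simp add: symm_mult_tr)
  also have "\<dots> = - (symm A * alt B)"
    using assms by (simp add: mult.assoc tr_mult_alt)
  finally show "symm A * alt B = (0 :: 'k alg)" by (rule eq_uminus_self_alg)
  have "alt B * symm A = alt B * (tr a b * (symm A :: 'k alg))"
    using assms by (simp add: tr_mult_symm)
  also have "\<dots> = - (alt B * symm A)"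
    using assms by (simp add: alt_mult_tr flip: mult.assoc)
  finally show "alt B * symm A = (0 :: 'k alg)" by (rule eq_uminus_self_alg)
qed

lemma permutes_conj_transpose:
  assumes "\<sigma> permutes A"
  shows "Transposition.transpose a b \<circ> \<sigma> \<circ> Transposition.transpose a b permutes
    Transposition.transpose a b ` A"
proof -
  let ?t = "Transposition.transpose a b"
  have "bij_betw (?t \<circ> \<sigma> \<circ> ?t) (?t ` A) (?t ` A)"
  proof (rule bij_betwI)
    show "?t \<circ> \<sigma> \<circ> ?t \<in> ?t ` A \<rightarrow> ?t ` A" "?t \<circ> inv_into UNIV \<sigma> \<circ> ?t \<in> ?t ` A \<rightarrow> ?t ` A"
      using permutes_in_image[OF assms] permutes_in_image[OF permutes_inv[OF assms]] by auto
  qed (use permutes_inverses[OF assms] in auto)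
  moreover have "(?t \<circ> \<sigma> \<circ> ?t) x = x" if "x \<notin> ?t ` A" for x
  proof -
    have "?t x \<notin> A" using that by (metis image_eqI transpose_involutory)
    then show ?thesis using permutes_not_in[OF assms] by simp
  qed
  ultimately show ?thesis by (rule bij_imp_permutes)
qed

text \<open>Reindexing by conjugation, an involution that preserves signs.\<close>

lemma
  fixes a b :: nat and A :: "nat set"
  defines "B \<equiv> Transposition.transpose a b ` A"
  assumes "finite A"
  shows tr_mult_symm_conj: "tr a b * symm A = (symm B * tr a b :: 'k::comm_ring_1 alg)"
    and tr_mult_alt_conj: "tr a b * alt A = (alt B * tr a b :: 'k::comm_ring_1 alg)"
proof -
  let ?t = "Transposition.transpose a b"
  have B: "?t ` B = A" by (simp add: B_def image_comp)
  have conj: "?t \<circ> \<sigma> \<circ> ?t permutes B" if "\<sigma> permutes A" for \<sigma>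
    unfolding B_def using that by (rule permutes_conj_transpose)
  have conj': "?t \<circ> \<sigma> \<circ> ?t permutes A" if "\<sigma> permutes B" for \<sigma>
    using permutes_conj_transpose[OF that, of a b] by (simp only: B)
  have t_t: "?t \<circ> ?t = id" by (simp add: fun_eq_iff)
  have inv: "?t \<circ> (?t \<circ> \<sigma> \<circ> ?t) \<circ> ?t = \<sigma>" for \<sigma> by (simp add: fun_eq_iff)
  have grp: "grp (?t \<circ> \<sigma> \<circ> ?t) * tr a b = tr a b * (grp \<sigma> :: 'k alg)" for \<sigma>
    by (simp add: tr_def t_t flip: grp_comp o_assoc)
  have sgn: "sign (?t \<circ> \<sigma> \<circ> ?t) = sign \<sigma>" if "\<sigma> permutes A" for \<sigma>
  proof -
    have "permutation \<sigma>" using that \<open>finite A\<close> by (auto simp: permutation_permutes)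
    then show ?thesis
      by (simp add: sign_compose permutation_compose permutation_swap_id sign_swap_id)
  qed
  show "tr a b * symm A = (symm B * tr a b :: 'k alg)"
    unfolding symm_def sum_distrib_left sum_distrib_right
    by (rule sum.reindex_bij_witness[of _ "\<lambda>\<sigma>. ?t \<circ> \<sigma> \<circ> ?t" "\<lambda>\<sigma>. ?t \<circ> \<sigma> \<circ> ?t"])
      (simp_all only: mem_Collect_eq conj conj' inv grp)
  show "tr a b * alt A = (alt B * tr a b :: 'k alg)"
    unfolding alt_def sum_distrib_left sum_distrib_right scl_mult_left scl_mult_right
    by (rule sum.reindex_bij_witness[of _ "\<lambda>\<sigma>. ?t \<circ> \<sigma> \<circ> ?t" "\<lambda>\<sigma>. ?t \<circ> \<sigma> \<circ> ?t"])
      (simp_all only: mem_Collect_eq conj conj' inv grp sgn)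
qed

lemma tr_symm_commute:
  assumes "finite A" "a \<notin> A" "b \<notin> A"
  shows "tr a b * symm A = (symm A * tr a b :: 'k::comm_ring_1 alg)"
proof -
  have "Transposition.transpose a b ` A = A"
    using assms by (force simp: Transposition.transpose_def image_iff)
  then show ?thesis
    using tr_mult_symm_conj[OF assms(1), of a b] by simp
qed

text \<open>Pulled through the antisymmetrizer, the transposition renames its strands; afterwards
  \<open>p\<close> and \<open>q\<close> belong to both sets.\<close>

lemma symm_tr_alt_zero:
  assumes "finite B" "p \<in> A" "q \<in> A" "p \<noteq> q"
    "Transposition.transpose a b p \<in> B" "Transposition.transpose a b q \<in> B"
  shows "symm A * tr a b * alt B = (0 :: 'k::field_char_0 alg)"
proof -
  have "p \<in> Transposition.transpose a b ` B" "q \<in> Transposition.transpose a b ` B"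
    using assms by (metis image_eqI transpose_involutory)+
  then have "symm A * alt (Transposition.transpose a b ` B) = (0 :: 'k alg)"
    using assms by (intro symm_mult_alt_zero[of _ p _ q]) auto
  then show ?thesis
    by (simp add: mult.assoc tr_mult_alt_conj assms) (simp flip: mult.assoc)
qed

lemma alt_tr_symm_zero:
  assumes "finite A" "finite B" "p \<in> A" "q \<in> A" "p \<noteq> q"
    "Transposition.transpose a b p \<in> B" "Transposition.transpose a b q \<in> B"
  shows "alt B * tr a b * symm A = (0 :: 'k::field_char_0 alg)"
proof -
  have "Transposition.transpose a b p \<noteq> Transposition.transpose a b q"
    using assms by (metis transpose_involutory)
  then have "alt B * symm (Transposition.transpose a b ` A) = (0 :: 'k alg)"
    using assms
    by (intro alt_mult_symm_zero[of _ "Transposition.transpose a b p" _ "Transposition.transpose a b q"])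
      auto
  then show ?thesis
    by (simp add: mult.assoc tr_mult_symm_conj assms) (simp flip: mult.assoc)
qed

section \<open>Coset expansions along an added strand\<close>

lemma symm_insert_right:
  assumes "finite S" "a \<notin> S"
  shows "symm (insert a S) = symm S * (\<Sum>c\<in>insert a S. tr a c :: 'k::comm_ring_1 alg)"
proof -
  have inv: "inv_into UNIV (Transposition.transpose a c \<circ> q) = inv_into UNIV q \<circ> Transposition.transpose a c"
    if "q permutes S" for c q
    using permutes_bij[OF that] by (simp add: o_inv_distrib)
  \<comment> \<open>The decomposition over \<open>insert a S\<close> puts the transposition on the
    left; summing over inverses moves it to the right.\<close>
  have "symm (insert a S) = (\<Sum>c\<in>insert a S. \<Sum>q | q permutes S. grp (inv_into UNIV q \<circ> Transposition.transpose a c) :: 'k alg)"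
    unfolding symm_def
    by (subst sum_permutations_inverse, subst sum_over_permutations_insert[OF assms])
      (intro sum.cong; simp only: inv mem_Collect_eq)
  also have "\<dots> = (\<Sum>q | q permutes S. grp (inv_into UNIV q)) * (\<Sum>c\<in>insert a S. tr a c)"
    unfolding sum_product tr_def grp_comp by (rule sum.swap)
  also have "(\<Sum>q | q permutes S. grp (inv_into UNIV q)) = (symm S :: 'k alg)"
    unfolding symm_def by (rule sum_permutations_inverse[symmetric])
  finally show "symm (insert a S) = symm S * (\<Sum>c\<in>insert a S. tr a c :: 'k alg)" .
qed

text \<open>The coset of \<open>c = a\<close> is represented by the identity with sign
  \<open>1\<close>, all others by transpositions with sign \<open>-1\<close>.\<close>

lemma
  fixes a :: nat and S :: "nat set"
  assumes "finite S" "a \<notin> S"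
  shows alt_insert_left: "alt (insert a S) = (1 - (\<Sum>c\<in>S. tr a c)) * (alt S :: 'k::comm_ring_1 alg)"
    and alt_insert_right: "alt (insert a S) = alt S * (1 - (\<Sum>c\<in>S. tr a c :: 'k::comm_ring_1 alg))"
proof -
  let ?t = "\<lambda>c. scl (of_int (sign (Transposition.transpose a c))) (tr a c) :: 'k alg"
  have perm: "permutation q" if "q permutes S" for q
    using that assms by (auto simp: permutation_permutes)
  have "(\<Sum>c\<in>S. ?t c) = (\<Sum>c\<in>S. - tr a c)"
    using assms by (intro sum.cong) (auto simp: sign_swap_id scl_minus_one)
  then have t: "(\<Sum>c\<in>insert a S. ?t c) = 1 - (\<Sum>c\<in>S. tr a c)"
    using assms by (simp add: sum_negf)
  show "alt (insert a S) = (1 - (\<Sum>c\<in>S. tr a c)) * (alt S :: 'k alg)"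
    unfolding t[symmetric] unfolding alt_def sum_over_permutations_insert[OF assms] sum_product tr_def
    by (intro sum.cong) (auto simp: grp_comp sign_compose perm permutation_swap_id mult.commute)
  have inv: "inv_into UNIV (Transposition.transpose a c \<circ> q) = inv_into UNIV q \<circ> Transposition.transpose a c"
    if "q permutes S" for c q
    using permutes_bij[OF that] by (simp add: o_inv_distrib)
  have "alt (insert a S) = (\<Sum>c\<in>insert a S. \<Sum>q | q permutes S.
      scl (of_int (sign (inv_into UNIV q \<circ> Transposition.transpose a c)))
        (grp (inv_into UNIV q \<circ> Transposition.transpose a c)) :: 'k alg)"
    unfolding alt_def
    by (subst sum_permutations_inverse, subst sum_over_permutations_insert[OF assms])
      (intro sum.cong; simp only: inv mem_Collect_eq)
  also have "\<dots> = (\<Sum>c\<in>insert a S. \<Sum>q | q permutes S.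
      scl (of_int (sign (inv_into UNIV q))) (grp (inv_into UNIV q)) * ?t c)"
    unfolding tr_def
    by (intro sum.cong)
      (auto simp: grp_comp sign_compose perm permutation_swap_id permutes_inv mult.commute)
  also have "\<dots> = (\<Sum>q | q permutes S. scl (of_int (sign (inv_into UNIV q))) (grp (inv_into UNIV q))) *
      (\<Sum>c\<in>insert a S. ?t c)"
    unfolding sum_product by (rule sum.swap)
  also have "(\<Sum>q | q permutes S. scl (of_int (sign (inv_into UNIV q))) (grp (inv_into UNIV q))) =
      (alt S :: 'k alg)"
    unfolding alt_def by (rule sum_permutations_inverse[symmetric])
  finally show "alt (insert a S) = alt S * (1 - (\<Sum>c\<in>S. tr a c :: 'k alg))"
    unfolding t .
qed

section \<open>Hook shapes\<close>

text \<open>Lets an equation for two factors rewrite inside a right-nested product.\<close>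

lemma mult_left_context: "x * y = z \<Longrightarrow> x * (y * w) = z * (w :: 'a::semigroup_mult)"
  by (simp flip: mult.assoc)

text \<open>The inner symmetrizer is expanded along \<open>a\<close>: its part on \<open>W\<close>
  commutes with \<open>tr a j\<close> and is absorbed by \<open>symm S\<close>, and of the coset sum
  only \<open>c = a\<close> survives, where \<open>alt B\<close> turns \<open>tr a j\<close> into
  \<open>-1\<close>. Leaving \<open>S\<close> and \<open>B\<close> general serves both the square of
  one hook and the mixed product \<open>Y' * Y\<close>.\<close>

lemma symm_tr_symm_alt:
  fixes a j :: nat and W S B :: "nat set"
  assumes "finite S" "finite B" "a \<notin> W" "insert a W \<subseteq> S" "a \<in> B" "j \<in> B" "j \<notin> insert a W"
  shows "symm S * tr a j * symm (insert a W) * alt B =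
    - scl (fact (card W)) (symm S * alt B :: 'k::field_char_0 alg)"
proof -
  let ?S = "symm S :: 'k alg" and ?B = "alt B :: 'k alg"
  have fW: "finite W" using assms by (meson finite_subset subset_insertI)
  have W: "?S * symm W = scl (fact (card W)) ?S"
    using assms by (intro symm_mult_symm_right) auto
  have comm: "tr a j * symm W = (symm W * tr a j :: 'k alg)"
    using assms fW by (intro tr_symm_commute) auto
  have zero: "?S * tr a j * tr a c * ?B = 0" if "c \<in> W" for c
  proof -
    have "a \<noteq> j" "c \<noteq> j" "a \<noteq> c" "c \<in> S" "a \<in> S" using assms that by auto
    \<comment> \<open>Conjugation moves \<open>tr a c\<close> to the left, where
      \<open>symm S\<close> absorbs it. The remaining \<open>tr c j\<close> carries the pair
      \<open>a\<close>, \<open>c\<close> of \<open>S\<close> to the pair \<open>a\<close>,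
      \<open>j\<close> of \<open>B\<close>.\<close>
    then have "?S * tr a j * tr a c * ?B = ?S * tr c j * ?B"
      by (simp add: mult.assoc tr_conj[THEN mult_left_context] symm_mult_tr[THEN mult_left_context])
    also have "\<dots> = 0"
      using assms \<open>a \<noteq> j\<close> \<open>c \<noteq> j\<close> \<open>a \<noteq> c\<close> \<open>c \<in> S\<close> \<open>a \<in> S\<close>
      by (intro symm_tr_alt_zero[of _ a _ c]) auto
    finally show ?thesis .
  qed
  have "?S * tr a j * symm (insert a W) * ?B =
      ?S * (tr a j * symm W) * (\<Sum>c\<in>insert a W. tr a c) * ?B"
    using assms fW by (simp only: symm_insert_right mult.assoc not_False_eq_True)
  also have "\<dots> = scl (fact (card W)) (\<Sum>c\<in>insert a W. ?S * tr a j * tr a c * ?B)"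
    unfolding comm mult.assoc[symmetric] W
    by (simp add: sum_distrib_left sum_distrib_right scl_sum mult.assoc del: sum.insert)
  also have "(\<Sum>c\<in>insert a W. ?S * tr a j * tr a c * ?B) = ?S * tr a j * ?B"
    using assms fW zero by simp
  also have "\<dots> = - (?S * ?B)"
    using assms by (simp add: mult.assoc tr_mult_alt)
  finally show ?thesis by (simp flip: scl_minus_one)
qed

text \<open>The constant is the product of the hook lengths: \<open>1 + card W + card D\<close> at
  the corner \<open>a\<close>, the factorials along arm and leg. It arises as \<open>card D!\<close>
  times \<open>(card W + 1)! + card D * card W!\<close>, the second summand coming from the
  transpositions in the expansion of the column.\<close>

lemma hook_square:
  fixes a :: nat and W D :: "nat set"
  assumes "finite W" "finite D" "a \<notin> W" "a \<notin> D" "W \<inter> D = {}"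
  defines "Y \<equiv> symm (insert a W) * alt (insert a D) :: 'k::field_char_0 alg"
  shows "Y * Y = scl (of_nat (1 + card W + card D) * fact (card W) * fact (card D)) Y"
proof -
  let ?R = "symm (insert a W) :: 'k alg" and ?C = "alt (insert a D) :: 'k alg" and ?A = "alt D :: 'k alg"
  have AR: "?A * ?R = ?R * ?A"
    using assms by (intro symm_alt_commute[symmetric]) auto
  have AC: "?A * ?C = scl (fact (card D)) ?C"
    using assms by (intro alt_mult_alt_left) auto
  have RR: "?R * ?R = scl (fact (card (insert a W))) ?R"
    using assms by (intro symm_mult_symm_left) auto
  have C: "?C = (1 - (\<Sum>j\<in>D. tr a j)) * ?A"
    using assms by (intro alt_insert_left)
  have "Y * Y = ?R * (1 - (\<Sum>j\<in>D. tr a j)) * (?A * ?R) * ?C"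
    unfolding Y_def by (subst C) (simp only: mult.assoc)
  also have "\<dots> = scl (fact (card D)) (?R * (1 - (\<Sum>j\<in>D. tr a j)) * ?R * ?C)"
    unfolding AR by (simp add: mult.assoc AC)
  also have "?R * (1 - (\<Sum>j\<in>D. tr a j)) * ?R * ?C =
      ?R * ?R * ?C - (\<Sum>j\<in>D. ?R * tr a j * ?R * ?C)"
    by (simp add: algebra_simps sum_distrib_left sum_distrib_right)
  also have "(\<Sum>j\<in>D. ?R * tr a j * ?R * ?C) = (\<Sum>j\<in>D. - scl (fact (card W)) Y)"
    unfolding Y_def using assms by (intro sum.cong symm_tr_symm_alt) auto
  also have "?R * ?R * ?C - \<dots> = scl (fact (card (insert a W)) + of_nat (card D) * fact (card W)) Y"
    unfolding RR by (simp add: Y_def scl_plus sum_const_scl sum_negf del: sum_constant)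
  finally show ?thesis
    using assms by (simp add: algebra_simps)
qed

text \<open>\<open>a\<close> is the corner of both hooks and \<open>d\<close> the one box that
  moves: it heads the leg of the first hook and ends the row of the second. \<open>W\<close> and
  \<open>D\<close> are the parts of arm and leg common to both.\<close>

locale hook_sets =
  fixes a d :: nat and W D :: "nat set" and K Y Y' X :: "'k::field_char_0 alg"
  assumes fin: "finite W" "finite D"
    and distinct: "a \<noteq> d" "a \<notin> W" "a \<notin> D" "d \<notin> W" "d \<notin> D" "W \<inter> D = {}"
    and K_def: "K = symm (insert a W) * alt (insert d D)"
    and Y_def: "Y = symm (insert a W) * alt (insert a (insert d D))"
    and Y'_def: "Y' = symm (insert d (insert a W)) * alt (insert a D)"
    and X_def: "X = K * tr a d * K"
begin

declare fact_Suc [simp del]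

abbreviation nf :: 'k where
  "nf \<equiv> fact (Suc (card W))"

abbreviation mf :: 'k where
  "mf \<equiv> fact (Suc (card D))"

lemma card_hook: "card (insert a W) = Suc (card W)" "card (insert d D) = Suc (card D)"
  using fin distinct by auto

lemma fin_hook: "finite (insert a W)" "finite (insert d D)" "finite (insert a D)"
  "finite (insert a (insert d D))" "finite (insert d (insert a W))"
  using fin by auto

lemma Y_square:
  "Y * Y = scl (of_nat (2 + card W + card D) * fact (card W) * mf) Y"
  using hook_square[of W "insert d D" a] fin distinct by (simp add: Y_def)

lemma Y'_square:
  "Y' * Y' = scl (of_nat (2 + card W + card D) * nf * fact (card D)) Y'"
proof -
  have "insert a (insert d W) = insert d (insert a W)" by auto
  then show ?thesis
    using hook_square[of "insert d W" D a] fin distinct by (simp add: Y'_def)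
qed

lemma alt_symm_K:
  "alt (insert d D) * symm (insert a W) = (symm (insert a W) * alt (insert d D) :: 'k alg)"
  using distinct by (intro symm_alt_commute[symmetric]) auto

lemma K_tr_left: "i \<in> insert a W \<Longrightarrow> j \<in> insert a W \<Longrightarrow> tr i j * K = K"
  by (simp add: K_def tr_mult_symm flip: mult.assoc)

lemma K_tr_right: "i \<in> insert a W \<Longrightarrow> j \<in> insert a W \<Longrightarrow> K * tr i j = K"
  unfolding K_def alt_symm_K[symmetric] by (simp add: mult.assoc symm_mult_tr)

lemma K_tr_left_neg: "i \<in> insert d D \<Longrightarrow> j \<in> insert d D \<Longrightarrow> i \<noteq> j \<Longrightarrow> tr i j * K = - K"
  unfolding K_def alt_symm_K[symmetric]
  by (simp add: mult.assoc[symmetric] tr_mult_alt fin)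

lemma K_tr_right_neg: "i \<in> insert d D \<Longrightarrow> j \<in> insert d D \<Longrightarrow> i \<noteq> j \<Longrightarrow> K * tr i j = - K"
  unfolding K_def by (simp add: mult.assoc alt_mult_tr fin)

lemma symm_square: "symm (insert a W) * symm (insert a W) = scl nf (symm (insert a W))"
  using symm_mult_symm_left[OF fin_hook(1) order.refl, where 'k = 'k] by (simp add: card_hook)

lemma alt_mult_alt_long:
  "alt (insert d D) * alt (insert a (insert d D)) = scl mf (alt (insert a (insert d D)))"
  "alt (insert a (insert d D)) * alt (insert d D) = scl mf (alt (insert a (insert d D)))"
  using alt_mult_alt_left[OF fin_hook(4), of "insert d D", where 'k = 'k]
    alt_mult_alt_right[OF fin_hook(4), of "insert d D", where 'k = 'k]
  by (auto simp: card_hook)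

lemma symm_mult_K: "symm (insert a W) * K = scl nf K"
  unfolding K_def by (simp add: symm_square[THEN mult_left_context])

lemma K_mult_symm: "K * symm (insert a W) = scl nf K"
  unfolding K_def alt_symm_K[symmetric] by (simp add: mult.assoc symm_square)

lemma alt_mult_K: "B \<subseteq> insert d D \<Longrightarrow> alt B * K = scl (fact (card B)) K"
  unfolding K_def alt_symm_K[symmetric]
  by (simp add: alt_mult_alt_left[OF fin_hook(2), THEN mult_left_context])

lemma K_square: "K * K = scl (nf * mf) K"
proof -
  have "K * K = symm (insert a W) * (alt (insert d D) * K)"
    by (simp add: K_def mult.assoc)
  then show ?thesis
    using alt_mult_K[of "insert d D"] by (simp add: card_hook symm_mult_K mult.commute)
qed

text \<open>With its commuting factors swapped, \<open>K\<close> presents \<open>A\<close> first,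
  and the column of \<open>Y\<close> contains all strands of \<open>A\<close>.\<close>

lemma Y_K: "Y * K = scl mf (Y * symm (insert a W))"
  unfolding Y_def K_def alt_symm_K[symmetric]
  by (simp add: mult.assoc alt_mult_alt_long(2)[THEN mult_left_context])

lemma symm_mult_Y: "symm (insert a W) * Y = scl nf Y"
  unfolding Y_def by (simp add: symm_square[THEN mult_left_context])

lemma Y_K_Y: "Y * K * Y = scl (nf * mf) (Y * Y)"
  by (simp add: Y_K symm_mult_Y mult.assoc mult.commute)

lemma symm_mult_Y': "symm (insert a W) * Y' = scl nf Y'"
proof -
  have "symm (insert a W) * symm (insert d (insert a W)) = scl nf (symm (insert d (insert a W)) :: 'k alg)"
    using symm_mult_symm_left[OF fin_hook(5), of "insert a W", where 'k = 'k] by (auto simp: card_hook)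
  then show ?thesis
    unfolding Y'_def by (simp flip: mult.assoc)
qed

text \<open>After absorption the column of the first hook meets the row of the second, and both
  contain \<open>a\<close> and \<open>d\<close>.\<close>

lemma Y_K_Y': "Y * K * Y' = 0"
proof -
  have "alt (insert a (insert d D)) * symm (insert d (insert a W)) = (0 :: 'k alg)"
    using fin_hook distinct by (intro alt_mult_symm_zero[of _ a _ d]) auto
  then have "Y * Y' = (0 :: 'k alg)"
    unfolding Y_def Y'_def by (simp add: mult.assoc) (simp flip: mult.assoc)
  then show ?thesis by (simp add: Y_K mult.assoc symm_mult_Y')
qed

text \<open>In this order the inner factors share only the corner and do not annihilate each other.
  Expanding the column of \<open>Y'\<close> along \<open>a\<close> lets \<open>alt D\<close> pass
  the row symmetrizer and be absorbed; every remaining term is a multiple of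
  \<open>?R' * ?C\<close>, whose factors share \<open>a\<close> and \<open>d\<close>.\<close>

lemma Y'_Y: "Y' * Y = 0"
proof -
  let ?R' = "symm (insert d (insert a W)) :: 'k alg" and ?R = "symm (insert a W) :: 'k alg"
  let ?C = "alt (insert a (insert d D)) :: 'k alg"
  have zero: "?R' * ?C = 0"
    using fin_hook distinct by (intro symm_mult_alt_zero[of _ a _ d]) auto
  have "alt D * ?R = ?R * alt D"
    using distinct by (intro symm_alt_commute[symmetric]) auto
  moreover have "alt D * ?C = scl (fact (card D)) ?C"
    using fin_hook by (intro alt_mult_alt_left) auto
  ultimately have Y: "alt D * Y = scl (fact (card D)) (?R * ?C)"
    unfolding Y_def by (simp flip: mult.assoc) (simp add: mult.assoc)
  have "Y' * Y = ?R' * (1 - (\<Sum>j\<in>D. tr a j)) * (alt D * Y)"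
    unfolding Y'_def using fin distinct by (simp add: alt_insert_left mult.assoc)
  also have "\<dots> = scl (fact (card D)) (?R' * ?R * ?C - (\<Sum>j\<in>D. ?R' * tr a j * ?R * ?C))"
    unfolding Y by (simp add: algebra_simps sum_distrib_left sum_distrib_right)
  also have "(\<Sum>j\<in>D. ?R' * tr a j * ?R * ?C) = (\<Sum>j\<in>D. 0)"
  proof (rule sum.cong)
    fix j assume "j \<in> D"
    then have "?R' * tr a j * ?R * ?C = - scl (fact (card W)) (?R' * ?C)"
      using fin_hook fin distinct by (intro symm_tr_symm_alt) auto
    then show "?R' * tr a j * ?R * ?C = 0" by (simp add: zero)
  qed simp
  also have "?R' * ?R = scl nf ?R'"
    using symm_mult_symm_right[OF fin_hook(5), of "insert a W", where 'k = 'k] by (auto simp: card_hook)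
  finally show ?thesis by (simp add: zero)
qed

lemma Y'_K_Y: "Y' * K * Y = 0"
proof -
  have "alt (insert d D) * Y = scl mf Y"
    unfolding Y_def
    by (simp add: alt_symm_K[THEN mult_left_context] alt_mult_alt_long mult.assoc)
  then show ?thesis
    unfolding K_def by (simp add: mult.assoc symm_mult_Y Y'_Y)
qed

text \<open>The column of \<open>Y'\<close> lacks \<open>d\<close>, so \<open>A\<close> is expanded
  along \<open>d\<close>: \<open>alt D\<close> is absorbed, and each \<open>tr d j\<close> gives
  zero because it carries the pair \<open>a\<close>, \<open>d\<close> of the row to the pair
  \<open>a\<close>, \<open>j\<close> of the column. Hence \<open>fact (card D)\<close> where the
  first hook has \<open>mf\<close>.\<close>

lemma Y'_K_Y': "Y' * K * Y' = scl (nf * fact (card D)) (Y' * Y')"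
proof -
  let ?R' = "symm (insert d (insert a W)) :: 'k alg" and ?C' = "alt (insert a D) :: 'k alg"
  have zero: "?C' * tr d j * ?R' = 0" if "j \<in> D" for j
  proof -
    have "a \<noteq> j" using distinct that by auto
    then show ?thesis
      using fin_hook distinct that by (intro alt_tr_symm_zero[of _ _ a d]) auto
  qed
  have C': "?C' * alt D = scl (fact (card D)) ?C'"
    using fin_hook by (intro alt_mult_alt_right) auto
  have "?C' * alt (insert d D) * ?R' = scl (fact (card D)) (?C' * (1 - (\<Sum>j\<in>D. tr d j)) * ?R')"
    using fin distinct
    by (simp only: alt_insert_right[of D d] not_False_eq_True mult.assoc C'[THEN mult_left_context] scl_mult_left)
  also have "?C' * (1 - (\<Sum>j\<in>D. tr d j)) * ?R' = ?C' * ?R' - (\<Sum>j\<in>D. ?C' * tr d j * ?R')"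
    by (simp add: algebra_simps sum_distrib_left sum_distrib_right)
  also have "\<dots> = ?C' * ?R'"
    by (simp add: zero)
  finally have "?C' * (alt (insert d D) * (?R' * ?C')) = scl (fact (card D)) (?C' * (?R' * ?C'))"
    by (simp flip: mult.assoc)
  then show ?thesis
    unfolding K_def alt_symm_K[symmetric]
    by (simp add: mult.assoc symm_mult_Y') (simp add: Y'_def mult.assoc)
qed

text \<open>\<open>tr a j\<close> is the conjugate of \<open>tr a d\<close> by
  \<open>tr d j\<close>, and the two signs produced at the copies of \<open>K\<close> cancel. In the
  row analogue \<open>K_tr_d_K\<close> no signs occur.\<close>

lemma K_tr_a_K: "j \<in> insert d D \<Longrightarrow> K * tr a j * K = X"
proof (cases "j = d")
  case False
  assume "j \<in> insert d D"
  then have j: "j \<in> D" "a \<noteq> j" using False distinct by auto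
  have "tr j d * (tr a d * tr d j) = (tr a j :: 'k alg)"
    unfolding tr_def grp_comp[symmetric]
    using j distinct False
    by (intro arg_cong[of _ _ grp]) (auto simp: fun_eq_iff Transposition.transpose_def)
  then have "K * tr a j * K = K * tr j d * tr a d * (tr d j * (K :: 'k alg))"
    by (simp add: mult.assoc) (simp flip: mult.assoc)
  then show ?thesis
    using j False by (simp add: K_tr_left_neg K_tr_right_neg X_def)
qed (simp add: X_def)

lemma K_tr_d_K: "i \<in> insert a W \<Longrightarrow> K * tr d i * K = X"
proof (cases "i = a")
  case False
  assume "i \<in> insert a W"
  then have i: "i \<in> W" "i \<noteq> d" using False distinct by auto
  have "tr a i * (tr a d * tr a i) = (tr d i :: 'k alg)"
    unfolding tr_def grp_comp[symmetric]
    using i distinct False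
    by (intro arg_cong[of _ _ grp]) (auto simp: fun_eq_iff Transposition.transpose_def)
  then have "K * tr d i * K = K * tr a i * tr a d * (tr a i * (K :: 'k alg))"
    by (simp add: mult.assoc) (simp flip: mult.assoc)
  then show ?thesis
    using i False by (simp add: K_tr_left K_tr_right X_def)
qed (simp add: X_def tr_commute)

text \<open>For \<open>i = a\<close> the 3-cycle is rewritten as \<open>tr a j * tr j d\<close>,
  whose second factor contributes \<open>-1\<close>. For other \<open>i\<close>, a
  \<open>tr a i\<close> inserted on the left reappears as \<open>tr d j\<close> on the right:
  \<open>K\<close> absorbs the former and negates the latter.\<close>

lemma K_tr_tr_K:
  assumes "i \<in> insert a W" "j \<in> D"
  shows "K * tr d i * tr a j * K = (if i = a then - X else 0)"
proof (cases "i = a")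
  case True
  have "a \<noteq> d" "j \<noteq> d" using assms distinct by auto
  then have "tr d a * tr a j = (tr a j * tr j d :: 'k alg)"
    unfolding tr_commute[of d a] by (rule tr_conj)
  then have "K * tr d a * tr a j * K = K * tr a j * (tr j d * (K :: 'k alg))"
    by (simp add: mult.assoc)
  also have "\<dots> = - X"
    using assms \<open>j \<noteq> d\<close> by (simp add: K_tr_left_neg K_tr_a_K)
  finally show ?thesis using True by simp
next
  case False
  then have ne: "i \<noteq> a" "i \<noteq> d" "i \<noteq> j" "j \<noteq> a" "j \<noteq> d" "i \<in> W"
    using assms distinct by auto
  have "tr a i * (tr d i * tr a j) = (tr d i * tr a j * tr d j :: 'k alg)"
    unfolding tr_def grp_comp[symmetric]
    using ne distinct
    by (intro arg_cong[of _ _ grp]) (auto simp: fun_eq_iff Transposition.transpose_def)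
  then have "K * tr a i * (tr d i * tr a j) * K = K * (tr d i * tr a j) * (tr d j * (K :: 'k alg))"
    by (simp add: mult.assoc)
  then have "K * (tr d i * tr a j) * K = - (K * (tr d i * tr a j) * (K :: 'k alg))"
    using ne assms by (simp add: K_tr_right K_tr_left_neg)
  then show ?thesis using False by (simp add: eq_uminus_self_alg mult.assoc)
qed

text \<open>The column is multiplied by \<open>A\<close> before it is expanded along the corner. The
  expansion then stands between two copies of \<open>K\<close>, and each of its
  \<open>card D + 1\<close> transpositions contributes \<open>X\<close>.\<close>

lemma K_Y_K:
  "K * Y * K = scl (nf * mf) (scl (nf * mf) K - scl (of_nat (Suc (card D))) X)"
proof -
  let ?R = "symm (insert a W) :: 'k alg" and ?A = "alt (insert d D) :: 'k alg"
  have "K * Y * K = K * ?R * alt (insert a (insert d D)) * (K :: 'k alg)"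
    by (simp add: Y_def mult.assoc)
  also have "\<dots> = scl nf (?R * (?A * alt (insert a (insert d D))) * K)"
    by (simp only: K_mult_symm scl_mult_left) (simp add: K_def mult.assoc)
  also note alt_mult_alt_long(1)
  also have "alt (insert a (insert d D)) = ?A * (1 - (\<Sum>j\<in>insert d D. tr a j))"
    using fin distinct by (intro alt_insert_right) auto
  also have "?R * scl mf (?A * (1 - (\<Sum>j\<in>insert d D. tr a j))) * K =
      scl mf (K * (1 - (\<Sum>j\<in>insert d D. tr a j)) * K)"
    by (simp add: K_def mult.assoc)
  also have "K * (1 - (\<Sum>j\<in>insert d D. tr a j)) * K =
      K * K - (\<Sum>j\<in>insert d D. K * tr a j * (K :: 'k alg))"
    by (simp add: algebra_simps sum_distrib_left sum_distrib_right del: sum.insert)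
  also have "(\<Sum>j\<in>insert d D. K * tr a j * (K :: 'k alg)) = (\<Sum>j\<in>insert d D. X)"
    by (intro sum.cong K_tr_a_K) auto
  finally show ?thesis
    by (simp add: K_square sum_const_scl card_hook del: sum_constant sum.insert)
qed

text \<open>The row is expanded along \<open>d\<close> on its right and the column along
  \<open>a\<close> on its left, so both expansions meet in the middle while the outer factors are
  absorbed. Each \<open>j\<close> gives \<open>-X\<close> by itself and \<open>X\<close> through its
  product with \<open>tr d a\<close>; these cancel, and only the row terms remain.\<close>

lemma K_Y'_K:
  "K * Y' * K = scl (nf * fact (card D)) (scl (nf * mf) K + scl (of_nat (Suc (card W))) X)"
proof -
  let ?I = "insert a W" and ?K = "K :: 'k alg"
  let ?S = "1 + (\<Sum>i\<in>?I. tr d i) :: 'k alg" and ?T = "1 - (\<Sum>j\<in>D. tr a j) :: 'k alg"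
  have "symm (insert d ?I) = symm ?I * ?S"
    using fin distinct by (subst symm_insert_right) auto
  moreover have "alt (insert a D) = ?T * alt D"
    using fin distinct by (intro alt_insert_left)
  ultimately have "?K * Y' * ?K = ?K * symm ?I * ?S * ?T * (alt D * ?K)"
    by (simp only: Y'_def mult.assoc)
  also have "\<dots> = scl (nf * fact (card D)) (?K * ?S * ?T * ?K)"
    by (simp add: K_mult_symm alt_mult_K subset_insertI mult.assoc mult.commute)
  also have "?K * ?S * ?T * ?K = ?K * ?K + (\<Sum>i\<in>?I. ?K * tr d i * ?K) - (\<Sum>j\<in>D. ?K * tr a j * ?K) -
      (\<Sum>j\<in>D. \<Sum>i\<in>?I. ?K * tr d i * tr a j * ?K)"
    by (simp add: algebra_simps sum_distrib_left sum_distrib_right sum.distrib del: sum.insert)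
  also have "(\<Sum>i\<in>?I. ?K * tr d i * ?K) = (\<Sum>i\<in>?I. X)"
    by (intro sum.cong K_tr_d_K) auto
  also have "(\<Sum>j\<in>D. ?K * tr a j * ?K) = (\<Sum>j\<in>D. X)"
    by (intro sum.cong K_tr_a_K) auto
  also have "(\<Sum>j\<in>D. \<Sum>i\<in>?I. ?K * tr d i * tr a j * ?K) = (\<Sum>j\<in>D. \<Sum>i\<in>?I. if i = a then - X else 0)"
    by (intro sum.cong K_tr_tr_K) auto
  also have "\<dots> = - (\<Sum>j\<in>D. X)"
    using fin by (simp add: sum_negf del: sum.insert sum_constant)
  finally show ?thesis
    by (simp add: K_square sum_const_scl card_hook del: sum_constant sum.insert)
qed

end

section \<open>Normalized idempotents and the resolution of \<open>H\<close>\<close>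

lemma scl_diff_left: "scl (c - d) x = scl c x - scl d x"
  using scl_plus[of "c - d" d x] by simp

context hook_sets
begin

abbreviation size_k :: 'k where
  "size_k \<equiv> of_nat (2 + card W + card D)"

definition E where "E = scl (1 / (size_k * fact (card W) * mf)) Y"
definition E' where "E' = scl (1 / (size_k * nf * fact (card D))) Y'"
definition H where "H = scl (1 / (nf * mf)) K"

lemma size_k_nonzero: "size_k \<noteq> 0"
  by (simp only: of_nat_eq_0_iff)

lemma H_idem: "H * H = H"
  by (simp add: H_def K_square)

lemma E_idem: "E * E = E"
  using size_k_nonzero by (simp add: E_def Y_square del: of_nat_add)

lemma E'_idem: "E' * E' = E'"
  using size_k_nonzero by (simp add: E'_def Y'_square del: of_nat_add)

lemma E_H_E: "E * H * E = E"
proof -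
  have "E * H * E = E * E"
    by (simp add: E_def H_def Y_K_Y)
  then show ?thesis by (simp add: E_idem)
qed

text \<open>\<open>H\<close> divides by \<open>nf * mf\<close>, whereas \<open>Y'_K_Y'\<close>
  supplies only \<open>nf * fact (card D)\<close>.\<close>

lemma E'_H_E': "scl (of_nat (Suc (card D))) (E' * H * E') = E'"
proof -
  define t h m where "t = 1 / (size_k * nf * fact (card D))" "h = 1 / (nf * mf)" "m = (of_nat (Suc (card D)) :: 'k)"
  have E': "E' = scl t Y'" and H: "H = scl h K"
    unfolding E'_def H_def t_h_m_def by (rule HOL.refl)+
  have mf: "mf = m * fact (card D)" and "m \<noteq> 0"
    by (simp_all add: t_h_m_def fact_Suc del: of_nat_Suc)
  have "scl m (E' * H * E') = scl (m * h * nf * fact (card D)) (E' * E')"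
    unfolding E' H by (simp add: Y'_K_Y') (simp add: ac_simps)
  also have "m * h * nf * fact (card D) = 1"
    using \<open>m \<noteq> 0\<close> by (simp add: t_h_m_def(2) mf)
  finally show ?thesis by (simp add: E'_idem t_h_m_def(3))
qed

lemma E_H_E': "E * H * E' = 0"
  by (simp add: E_def E'_def H_def Y_K_Y')

lemma E'_H_E: "E' * H * E = 0"
  by (simp add: E_def E'_def H_def Y'_K_Y)

text \<open>With \<open>n = card W + 1\<close> and \<open>m = card D + 1\<close>, the terms
  contribute the shares \<open>n / (n + m)\<close> and \<open>m / (n + m)\<close> of
  \<open>H\<close>, and their multiples of \<open>X\<close> are opposite.\<close>

lemma H_decomposition: "H * E * H + scl (of_nat (Suc (card D))) (H * E' * H) = H"
proof -
  \<comment> \<open>Factorials become nonzero letters, which leaves two rational identities for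
    \<open>divide_simps\<close>.\<close>
  define w c n m s :: 'k
    where "w = fact (card W)" "c = fact (card D)" "n = of_nat (Suc (card W))" "m = of_nat (Suc (card D))"
      "s = size_k"
  have nm: "nf = n * w" "mf = m * c" "s = n + m"
    by (simp_all add: w_c_n_m_s_def fact_Suc)
  have nz: "w \<noteq> 0" "c \<noteq> 0" "n \<noteq> 0" "m \<noteq> 0" "s \<noteq> 0"
    using size_k_nonzero by (simp_all add: w_c_n_m_s_def del: of_nat_Suc of_nat_add)
  define h where "h = 1 / (nf * mf)"
  define e where "e = 1 / (s * w * mf)"
  define e' where "e' = 1 / (s * nf * c)"
  have H: "H = scl h K" and E: "E = scl e Y" and E': "E' = scl e' Y'"
    unfolding H_def E_def E'_def h_def e_def e'_def w_c_n_m_s_def by (rule HOL.refl)+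
  have "H * E * H + scl m (H * E' * H) =
      scl (h * e * h * (nf * mf) * (nf * mf) + m * (h * e' * h * (nf * c)) * (nf * mf)) K +
      scl (m * (h * e' * h * (nf * c)) * n - h * e * h * (nf * mf) * m) X"
    unfolding H E E'
    by (simp add: K_Y_K K_Y'_K scl_add scl_diff scl_plus scl_diff_left del: of_nat_Suc
      flip: w_c_n_m_s_def) (simp add: algebra_simps)
  also have "h * e * h * (nf * mf) * (nf * mf) + m * (h * e' * h * (nf * c)) * (nf * mf) = (n + m) / s * h"
    unfolding h_def e_def e'_def nm(1,2) using nz by (simp add: divide_simps)
  also have "m * (h * e' * h * (nf * c)) * n - h * e * h * (nf * mf) * m = 0"
    unfolding h_def e_def e'_def nm(1,2) using nz by (simp add: divide_simps)
  finally show ?thesis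
    using nz(5) by (simp add: nm(3)[symmetric]) (simp add: H_def w_c_n_m_s_def h_def)
qed

end

section \<open>Coefficient functions\<close>

text \<open>\<open>F\<close> stands for the basis of the ring or for the diagrams of permutations,
  \<open>sc\<close> for the respective scalar action; one reindexing thus serves \<open>emb\<close>
  and \<open>mor_of\<close>.\<close>

lemma sum_gmult:
  fixes F :: "(nat \<Rightarrow> nat) \<Rightarrow> 'a::semiring_0" and sc :: "'k::field \<Rightarrow> 'a \<Rightarrow> 'a"
  assumes hom: "\<And>\<sigma> \<tau>. \<sigma> permutes {..<r} \<Longrightarrow> \<tau> permutes {..<r} \<Longrightarrow> F (\<sigma> \<circ> \<tau>) = F \<sigma> * F \<tau>"
    and mult: "\<And>c d x y. sc c x * sc d y = sc (c * d) (x * y)"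
    and sum: "\<And>f A x. sc (sum f A) x = (\<Sum>a\<in>(A :: (nat \<Rightarrow> nat) set). sc (f a) x)"
  shows "(\<Sum>\<sigma> | \<sigma> permutes {..<r}. sc (gmult r x y \<sigma>) (F \<sigma>)) =
    (\<Sum>\<sigma> | \<sigma> permutes {..<r}. sc (x \<sigma>) (F \<sigma>)) * (\<Sum>\<sigma> | \<sigma> permutes {..<r}. sc (y \<sigma>) (F \<sigma>))"
proof -
  let ?P = "{\<sigma>. \<sigma> permutes {..<r}}"
  have "(\<Sum>\<sigma>\<in>?P. sc (gmult r x y \<sigma>) (F \<sigma>)) =
      (\<Sum>\<tau>\<in>?P. \<Sum>\<sigma>\<in>?P. sc (x \<tau> * y (inv_into UNIV \<tau> \<circ> \<sigma>)) (F \<sigma>))"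
    unfolding gmult_def sum by (rule sum.swap)
  also have "\<dots> = (\<Sum>\<tau>\<in>?P. \<Sum>\<sigma>\<in>?P. sc (x \<tau>) (F \<tau>) * sc (y \<sigma>) (F \<sigma>))"
  proof (rule sum.cong[OF HOL.refl])
    fix \<tau> assume "\<tau> \<in> ?P"
    then have \<tau>: "\<tau> permutes {..<r}" by simp
    have "(\<Sum>\<sigma>\<in>?P. sc (x \<tau> * y (inv_into UNIV \<tau> \<circ> \<sigma>)) (F \<sigma>)) =
        (\<Sum>\<sigma>\<in>?P. sc (x \<tau> * y (inv_into UNIV \<tau> \<circ> (\<tau> \<circ> \<sigma>))) (F (\<tau> \<circ> \<sigma>)))"
      by (rule setum_permutations_compose_left[OF \<tau>])
    also have "\<dots> = (\<Sum>\<sigma>\<in>?P. sc (x \<tau>) (F \<tau>) * sc (y \<sigma>) (F \<sigma>))"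
      using permutes_inv_o(2)[OF \<tau>] by (intro sum.cong) (simp_all add: o_assoc hom \<tau> mult)
    finally show "(\<Sum>\<sigma>\<in>?P. sc (x \<tau> * y (inv_into UNIV \<tau> \<circ> \<sigma>)) (F \<sigma>)) =
        (\<Sum>\<sigma>\<in>?P. sc (x \<tau>) (F \<tau>) * sc (y \<sigma>) (F \<sigma>))" .
  qed
  finally show ?thesis by (simp only: sum_product)
qed

definition emb :: "nat \<Rightarrow> 'k::field grpalg \<Rightarrow> 'k alg" where
  "emb r x = (\<Sum>\<sigma> | \<sigma> permutes {..<r}. scl (x \<sigma>) (grp \<sigma>))"

lemma emb_gmult: "emb r (gmult r x y) = emb r x * emb r y"
  unfolding emb_def
  by (rule sum_gmult) (simp_all add: grp_comp scl_sum_left mult.commute[of "_ :: 'a"])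

lemma lookup_emb:
  "Poly_Mapping.lookup (emb r x) (Endo \<sigma>) = (if \<sigma> permutes {..<r} then x \<sigma> else 0)"
proof -
  have "Poly_Mapping.lookup (emb r x) (Endo \<sigma>) =
      (\<Sum>\<tau> | \<tau> permutes {..<r}. if \<tau> = \<sigma> then x \<tau> else 0)"
    unfolding emb_def lookup_sum by (intro sum.cong) (auto simp: lookup_scl lookup_grp)
  then show ?thesis by (simp add: finite_permutations sum.delta')
qed

lemma emb_scale: "emb r (\<lambda>\<sigma>. c * x \<sigma>) = scl c (emb r x)"
  by (simp add: emb_def scl_sum)

text \<open>Reading off only the coefficients on \<open>S\<^sub>r\<close> gives a linear map on the
  whole ring. Multiplicativity is restricted to the image of \<open>emb\<close>, since factors
  outside \<open>S\<^sub>r\<close> can have a product inside it.\<close>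

definition mor_of :: "nat \<Rightarrow> 'k::field alg \<Rightarrow> 'k mor" where
  "mor_of r z = (\<Sum>\<sigma> | \<sigma> permutes {..<r}. scale (Poly_Mapping.lookup z (Endo \<sigma>)) (perm_mor r \<sigma>))"

lemma grpalg_mor_emb: "grpalg_mor r x = single (mor_of r (emb r x))"
  by (simp add: grpalg_mor_def mor_of_def lookup_emb)

lemma mor_of_add: "mor_of r (z + w) = mor_of r z + mor_of r w"
  by (simp add: mor_of_def lookup_add scale_plus sum.distrib)

lemma mor_of_scl: "mor_of r (scl c z) = scale c (mor_of r z)"
  by (simp add: mor_of_def lookup_scl scale_sum)

lemma mor_of_zero: "mor_of r 0 = 0"
  by (simp add: mor_of_def)

lemma mor_of_sum: "mor_of r (sum f A) = (\<Sum>a\<in>A. mor_of r (f a))"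
  by (induction A rule: infinite_finite_induct) (auto simp: mor_of_add mor_of_zero)

lemma mor_of_mult:
  assumes "z \<in> range (emb r)" "w \<in> range (emb r)"
  shows "mor_of r (z * w) = mor_of r z * mor_of r w"
proof -
  obtain x y where "z = emb r x" "w = emb r y" using assms by auto
  moreover have "(\<Sum>\<sigma> | \<sigma> permutes {..<r}. scale (gmult r x y \<sigma>) (perm_mor r \<sigma>)) =
      (\<Sum>\<sigma> | \<sigma> permutes {..<r}. scale (x \<sigma>) (perm_mor r \<sigma>)) *
      (\<Sum>\<sigma> | \<sigma> permutes {..<r}. scale (y \<sigma>) (perm_mor r \<sigma>))"
    by (rule sum_gmult) (simp_all add: perm_mor_compose scale_sum_left mult.commute[of "_ :: 'a"])
  ultimately show ?thesis
    by (simp add: mor_of_def lookup_emb flip: emb_gmult)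
qed

lemma mor_of_whom: "mor_of r z \<in> whom (ups r) (ups r)"
  unfolding mor_of_def by (intro sum_whom scale_whom perm_mor_whom) auto

lemma grp_eq_emb:
  assumes "\<sigma> permutes {..<r}"
  shows "grp \<sigma> = (emb r (\<lambda>\<tau>. if \<tau> = \<sigma> then 1 else 0) :: 'k::field alg)"
proof -
  have "(emb r (\<lambda>\<tau>. if \<tau> = \<sigma> then 1 else 0) :: 'k alg) =
      (\<Sum>\<tau> | \<tau> permutes {..<r}. if \<tau> = \<sigma> then grp \<tau> else 0)"
    unfolding emb_def by (intro sum.cong) auto
  then show ?thesis using assms by (simp add: finite_permutations sum.delta')
qed

lemma mor_of_grp:
  assumes "\<sigma> permutes {..<r}"
  shows "mor_of r (grp \<sigma>) = perm_mor r \<sigma>"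
proof -
  have "mor_of r (grp \<sigma>) = (\<Sum>\<tau> | \<tau> permutes {..<r}. if \<tau> = \<sigma> then perm_mor r \<tau> else 0)"
    unfolding mor_of_def by (intro sum.cong) (auto simp: lookup_grp)
  then show ?thesis using assms by (simp add: finite_permutations sum.delta')
qed

lemma range_emb_grp: "\<sigma> permutes {..<r} \<Longrightarrow> grp \<sigma> \<in> range (emb r)"
  by (metis grp_eq_emb rangeI)

lemma range_emb_mult: "z \<in> range (emb r) \<Longrightarrow> w \<in> range (emb r) \<Longrightarrow> z * w \<in> range (emb r)"
  by (auto simp flip: emb_gmult)

lemma range_emb_scl: "z \<in> range (emb r) \<Longrightarrow> scl c z \<in> range (emb r)"
  by (auto simp flip: emb_scale)

lemma range_emb_add: "z \<in> range (emb r) \<Longrightarrow> w \<in> range (emb r) \<Longrightarrow> z + w \<in> range (emb r)"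
proof -
  have "emb r x + emb r y = emb r (\<lambda>\<sigma>. x \<sigma> + y \<sigma>)" for x y :: "'a grpalg"
    by (simp add: emb_def scl_plus sum.distrib)
  then show "z \<in> range (emb r) \<Longrightarrow> w \<in> range (emb r) \<Longrightarrow> z + w \<in> range (emb r)" by auto
qed

lemma range_emb_sum: "(\<And>a. a \<in> A \<Longrightarrow> f a \<in> range (emb r)) \<Longrightarrow> sum f A \<in> range (emb r)"
proof (induction A rule: infinite_finite_induct)
  case (infinite A)
  then show ?case using emb_scale[of r 0] by (auto intro: range_eqI[of _ _ "\<lambda>_. 0"] simp: emb_def)
next
  case empty
  show ?case by (auto intro: range_eqI[of _ _ "\<lambda>_. 0"] simp: emb_def)
qed (auto intro: range_emb_add)

lemma range_emb_symm: "A \<subseteq> {..<r} \<Longrightarrow> symm A \<in> range (emb r)"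
  unfolding symm_def by (intro range_emb_sum range_emb_grp) (auto intro: permutes_subset)

lemma range_emb_alt: "A \<subseteq> {..<r} \<Longrightarrow> alt A \<in> range (emb r)"
  unfolding alt_def by (intro range_emb_sum range_emb_scl range_emb_grp) (auto intro: permutes_subset)

lemma
  assumes "A \<subseteq> {..<r}"
  shows emb_indicator_symm: "emb r (\<lambda>\<sigma>. if \<sigma> permutes A then 1 else 0) = symm A"
    and emb_indicator_alt: "emb r (\<lambda>\<sigma>. if \<sigma> permutes A then of_int (sign \<sigma>) else 0) = alt A"
proof -
  have sub: "\<sigma> permutes {..<r}" if "\<sigma> permutes A" for \<sigma>
    using that assms by (rule permutes_subset)
  show "emb r (\<lambda>\<sigma>. if \<sigma> permutes A then 1 else 0) = symm A"
    "emb r (\<lambda>\<sigma>. if \<sigma> permutes A then of_int (sign \<sigma>) else 0) = alt A"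
    unfolding emb_def symm_def alt_def using sub
    by (auto intro!: sum.mono_neutral_cong_right simp: finite_permutations split: if_splits)
qed

lemma emb_complete_sym: "emb r (complete_sym r) = scl (1 / fact r) (symm {..<r})"
  by (simp add: emb_def complete_sym_def symm_def scl_sum)

lemma emb_complete_antisym: "emb r (complete_antisym r) = scl (1 / fact r) (alt {..<r})"
  by (simp add: emb_def complete_antisym_def alt_def scl_sum)

lemma gmult_supported:
  assumes "\<And>\<sigma>. \<not> \<sigma> permutes {..<r} \<Longrightarrow> y \<sigma> = 0" "\<not> \<sigma> permutes {..<r}"
  shows "gmult r x y \<sigma> = 0"
proof -
  have "y (inv_into UNIV \<tau> \<circ> \<sigma>) = 0" if \<tau>: "\<tau> permutes {..<r}" for \<tau>
  proof (rule assms(1), rule notI)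
    assume "inv_into UNIV \<tau> \<circ> \<sigma> permutes {..<r}"
    from permutes_compose[OF this \<tau>] have "\<sigma> permutes {..<r}"
      by (simp add: o_assoc permutes_inv_o(1)[OF \<tau>])
    with assms(2) show False ..
  qed
  then show ?thesis by (simp add: gmult_def)
qed

text \<open>\<open>emb\<close> sees coefficients on \<open>S\<^sub>r\<close> only, while the
  idempotency equation in \<open>young_scalar\<close> compares functions everywhere; vanishing off
  \<open>S\<^sub>r\<close> closes the gap.\<close>

lemma emb_eq_iff:
  assumes "\<And>\<sigma>. \<not> \<sigma> permutes {..<r} \<Longrightarrow> x \<sigma> = 0" "\<And>\<sigma>. \<not> \<sigma> permutes {..<r} \<Longrightarrow> y \<sigma> = 0"
  shows "emb r x = emb r y \<longleftrightarrow> x = y"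
proof
  assume eq: "emb r x = emb r y"
  show "x = y"
  proof
    fix \<sigma>
    show "x \<sigma> = y \<sigma>"
      using assms lookup_emb[of r x \<sigma>] lookup_emb[of r y \<sigma>] eq by (cases "\<sigma> permutes {..<r}") auto
  qed
qed simp

section \<open>Young symmetrizers of hooks\<close>

lemma sum_list_hook [simp]: "sum_list (hook n m) = n + m"
  by (simp add: hook_def sum_list_replicate)

lemma row_of_hook: "row_of (hook n m) i = (if i < n then 0 else Suc (min (i - n) m))"
proof -
  \<comment> \<open>Past the last row \<open>row_of\<close> ends in its default value
    \<open>0\<close>, whence the \<open>min\<close>; inside the shape the row is
    \<open>k\<close>.\<close>
  have "row_of (replicate m 1) k = min k m" for k
    by (induction m arbitrary: k) auto
  then show ?thesis by (simp add: hook_def)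
qed

lemma col_of_hook: "col_of (hook n m) i = (if i < n then i else 0)"
proof -
  have "col_of (replicate m 1) k = 0" for k
    by (induction m arbitrary: k) auto
  then show ?thesis by (simp add: hook_def)
qed

lemma row_symmetrizer_hook:
  "row_symmetrizer (hook n m) = (\<lambda>\<sigma>. if \<sigma> permutes {..<n} then 1 else 0)"
proof -
  have "\<sigma> permutes {..<n}"
    if \<sigma>: "\<sigma> permutes {..<n + m}" and row: "\<forall>i<n + m. row_of (hook n m) (\<sigma> i) = row_of (hook n m) i"
    for \<sigma>
  proof (rule permutes_superset[OF \<sigma>])
    fix i assume i: "i \<in> {..<n + m} - {..<n}"
    then have "\<sigma> i < n + m" using permutes_in_image[OF \<sigma>, of i] by auto
    with i row[rule_format, of i] show "\<sigma> i = i"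
      by (auto simp: row_of_hook split: if_splits)
  qed
  moreover have "\<sigma> permutes {..<n + m}" if "\<sigma> permutes {..<n}" for \<sigma>
    using that by (rule permutes_subset) auto
  moreover have "row_of (hook n m) (\<sigma> i) = row_of (hook n m) i" if "\<sigma> permutes {..<n}" for \<sigma> i
    using permutes_in_image[OF that, of i] permutes_not_in[OF that, of i] by (auto simp: row_of_hook)
  ultimately show ?thesis
    unfolding row_symmetrizer_def sum_list_hook by (intro ext) (metis (no_types, lifting))
qed

text \<open>Every column but the first is a single box, so preserving columns means fixing those
  strands; the first consists of the corner \<open>0\<close> and the leg.\<close>

lemma col_antisymmetrizer_hook:
  assumes "n \<ge> 1"
  shows "col_antisymmetrizer (hook n m) =
    (\<lambda>\<sigma>. if \<sigma> permutes insert 0 {n..<n + m} then of_int (sign \<sigma>) else 0)"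
proof -
  have "\<sigma> permutes insert 0 {n..<n + m}"
    if \<sigma>: "\<sigma> permutes {..<n + m}" and col: "\<forall>i<n + m. col_of (hook n m) (\<sigma> i) = col_of (hook n m) i"
    for \<sigma>
  proof (rule permutes_superset[OF \<sigma>])
    fix i assume "i \<in> {..<n + m} - insert 0 {n..<n + m}"
    with col[rule_format, of i] show "\<sigma> i = i"
      by (auto simp: col_of_hook split: if_splits)
  qed
  moreover have "\<sigma> permutes {..<n + m}" if "\<sigma> permutes insert 0 {n..<n + m}" for \<sigma>
    using that by (rule permutes_subset) (use assms in auto)
  moreover have "col_of (hook n m) (\<sigma> i) = col_of (hook n m) i"
    if "\<sigma> permutes insert 0 {n..<n + m}" for \<sigma> i
    using permutes_in_image[OF that, of i] permutes_not_in[OF that, of i]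
    by (cases "i \<in> insert 0 {n..<n + m}") (auto simp: col_of_hook)
  ultimately show ?thesis
    unfolding col_antisymmetrizer_def sum_list_hook by (intro ext) (metis (no_types, lifting))
qed

lemma emb_young_symmetrizer_hook:
  assumes "n \<ge> 1"
  shows "emb (n + m) (young_symmetrizer (hook n m)) = symm {..<n} * alt (insert 0 {n..<n + m})"
proof -
  have "insert 0 {n..<n + m} \<subseteq> {..<n + m}" using assms by auto
  then show ?thesis
    by (simp add: young_symmetrizer_def emb_gmult row_symmetrizer_hook
      col_antisymmetrizer_hook[OF assms] emb_indicator_symm emb_indicator_alt)
qed

lemma young_symmetrizer_supported:
  "\<not> \<sigma> permutes {..<sum_list \<mu>} \<Longrightarrow> young_symmetrizer \<mu> \<sigma> = 0"
  unfolding young_symmetrizer_def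
  by (rule gmult_supported) (simp_all add: col_antisymmetrizer_def)

text \<open>Row and column group share only the strand \<open>0\<close> and so meet in the identity.
  The nonzero coefficient is what makes the scalar of the idempotent unique.\<close>

lemma young_symmetrizer_hook_id:
  assumes "n \<ge> 1"
  shows "young_symmetrizer (hook n m) id = 1"
proof -
  let ?C = "insert 0 {n..<n + m}"
  have "row_symmetrizer (hook n m) \<tau> * col_antisymmetrizer (hook n m) (inv_into UNIV \<tau> \<circ> id) =
      (if \<tau> = id then 1 else 0 :: 'a)" for \<tau>
  proof (cases "\<tau> permutes {..<n} \<and> inv_into UNIV \<tau> permutes ?C")
    case True
    then have R: "\<tau> permutes {..<n}" and "inv_into UNIV \<tau> permutes ?C" by auto
    from permutes_inv[OF this(2)] have C: "\<tau> permutes ?C"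
      by (simp add: permutes_bij[OF R] inv_inv_eq)
    have "\<tau> x = x" for x
    proof (cases "x = 0")
      case True
      then have "\<tau> x \<in> {..<n}" "\<tau> x \<in> ?C"
        using assms permutes_in_image[OF R, of x] permutes_in_image[OF C, of x] by auto
      then show ?thesis using True by auto
    next
      case False
      then have "x \<notin> {..<n} \<or> x \<notin> ?C" by auto
      then show ?thesis using permutes_not_in[OF R] permutes_not_in[OF C] by blast
    qed
    then have "\<tau> = id" by (simp add: fun_eq_iff)
    then show ?thesis
      by (simp add: row_symmetrizer_hook col_antisymmetrizer_hook[OF assms] permutes_id)
  next
    case False
    then have "\<tau> \<noteq> id" using permutes_id by auto
    with False show ?thesis
      by (auto simp: row_symmetrizer_hook col_antisymmetrizer_hook[OF assms])
  qed
  then show ?thesis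
    by (simp add: young_symmetrizer_def gmult_def permutes_id finite_permutations sum.delta)
qed

text \<open>At a coefficient where the symmetrizer does not vanish, idempotency reads
  \<open>\<alpha> * \<alpha> * \<kappa> = \<alpha>\<close>, with \<open>1 / \<kappa>\<close> as its
  only nonzero solution.\<close>

lemma young_scalar_eq:
  fixes \<mu> :: "nat list" and \<kappa> :: "'k::field"
  defines "z \<equiv> emb (sum_list \<mu>) (young_symmetrizer \<mu>)"
  assumes sq: "z * z = scl \<kappa> z" and "\<kappa> \<noteq> 0" and nz: "young_symmetrizer \<mu> \<sigma> \<noteq> (0 :: 'k)"
  shows "young_scalar \<mu> = 1 / \<kappa>"
proof -
  let ?r = "sum_list \<mu>"
  have \<sigma>: "\<sigma> permutes {..<?r}" using nz young_symmetrizer_supported by metis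
  have iff: "(let e = (\<lambda>\<sigma>. \<alpha> * young_symmetrizer \<mu> \<sigma>) in gmult ?r e e = e) \<longleftrightarrow>
      scl (\<alpha> * \<alpha> * \<kappa>) z = scl \<alpha> z" for \<alpha>
  proof -
    let ?e = "\<lambda>\<sigma>. \<alpha> * young_symmetrizer \<mu> \<sigma>"
    have "gmult ?r ?e ?e = ?e \<longleftrightarrow> emb ?r (gmult ?r ?e ?e) = emb ?r ?e"
      by (subst emb_eq_iff) (auto simp: young_symmetrizer_supported intro: gmult_supported)
    then show ?thesis by (simp add: emb_gmult emb_scale sq Let_def mult.assoc flip: z_def)
  qed
  have unique: "\<alpha> = 1 / \<kappa>" if "\<alpha> \<noteq> 0" "scl (\<alpha> * \<alpha> * \<kappa>) z = scl \<alpha> z" for \<alpha>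
  proof -
    have "Poly_Mapping.lookup z (Endo \<sigma>) \<noteq> 0" using nz \<sigma> by (simp add: z_def lookup_emb)
    moreover have "\<alpha> * \<alpha> * \<kappa> * Poly_Mapping.lookup z (Endo \<sigma>) = \<alpha> * Poly_Mapping.lookup z (Endo \<sigma>)"
      using that(2) by (metis lookup_scl)
    ultimately show ?thesis using that(1) \<open>\<kappa> \<noteq> 0\<close> by (simp add: field_simps)
  qed
  show ?thesis
    unfolding young_scalar_def iff
    using \<open>\<kappa> \<noteq> 0\<close> unique by (intro the_equality) auto
qed

lemma emb_young_idempotent_hook:
  assumes "n \<ge> 1"
  shows "emb (n + m) (young_idempotent (hook n m)) =
    scl (1 / (of_nat (n + m) * fact (n - 1) * fact m))
      (symm {..<n} * alt (insert 0 {n..<n + m}) :: 'k::field_char_0 alg)"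
proof -
  let ?Y = "symm {..<n} * alt (insert 0 {n..<n + m}) :: 'k alg"
  have W: "insert 0 {1..<n} = {..<n}" and sz: "1 + (n - 1) + m = n + m" using assms by auto
  have "?Y * ?Y = scl (of_nat (n + m) * fact (n - 1) * fact m) ?Y"
    using hook_square[of "{1..<n}" "{n..<n + m}" 0, where 'k = 'k] assms
    by (simp only: W sz card_atLeastLessThan add_diff_cancel_left') auto
  then have "young_scalar (hook n m) = 1 / (of_nat (n + m) * fact (n - 1) * fact m :: 'k)"
    using assms young_symmetrizer_hook_id[OF assms, of m, where 'a = 'k]
    by (intro young_scalar_eq[of _ _ id])
      (simp_all add: emb_young_symmetrizer_hook del: of_nat_add)
  then show ?thesis
    unfolding young_idempotent_def emb_scale by (simp only: emb_young_symmetrizer_hook[OF assms])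
qed

section \<open>The idempotent \<open>h\<^sub>n \<otimes> a\<^sub>m\<close>\<close>

text \<open>As transport along an injection, the shift inherits its support and its sign from
  \<open>map_permutation\<close>.\<close>

lemma shift_perm_eq:
  assumes "\<tau> permutes {..<m}"
  shows "shift_perm n \<tau> = map_permutation {..<m} ((+) n) \<tau>"
proof
  fix i
  show "shift_perm n \<tau> i = map_permutation {..<m} ((+) n) \<tau> i"
  proof (cases "i \<in> (+) n ` {..<m}")
    case True
    then obtain k where k: "i = n + k" "k < m" by auto
    then show ?thesis
      by (simp add: shift_perm_def map_permutation_def inv_into_f_f)
  next
    case False
    moreover have "i - n \<notin> {..<m}" if "\<not> i < n"
      using False that by (metis image_eqI le_add_diff_inverse linorder_not_less)
    ultimately show ?thesis
      using permutes_not_in[OF assms, of "i - n"] by (auto simp: shift_perm_def map_permutation_def)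
  qed
qed

lemma add_bij_betw: "bij_betw ((+) n) {..<m} {n..<n + m}" for n m :: nat
  by (rule bij_betwI[of _ _ _ "\<lambda>i. i - n"]) auto

lemma shift_perm_permutes: "\<tau> permutes {..<m} \<Longrightarrow> shift_perm n \<tau> permutes {n..<n + m}"
  unfolding shift_perm_eq by (rule map_permutation_permutes[OF add_bij_betw])

lemma sign_shift_perm: "\<tau> permutes {..<m} \<Longrightarrow> sign (shift_perm n \<tau>) = sign \<tau>"
  unfolding shift_perm_eq by (rule sign_map_permutation) auto

lemma bij_betw_shift_perm:
  "bij_betw (shift_perm n) {\<tau>. \<tau> permutes {..<m}} {\<tau>. \<tau> permutes {n..<n + m}}"
proof (rule bij_betwI[of _ _ _ "\<lambda>\<tau> i. \<tau> (n + i) - n"])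
  show "(\<lambda>\<tau> i. \<tau> (n + i) - n) \<in> {\<tau>. \<tau> permutes {n..<n + m}} \<rightarrow> {\<tau>. \<tau> permutes {..<m}}"
  proof
    fix \<tau> assume "\<tau> \<in> {\<tau>. \<tau> permutes {n..<n + m}}"
    then have \<tau>: "\<tau> permutes {n..<n + m}" by simp
    have inv: "inv_into UNIV \<tau> permutes {n..<n + m}" using \<tau> by (rule permutes_inv)
    have ge: "n \<le> \<pi> (n + i)" "n + i < n + m \<Longrightarrow> \<pi> (n + i) < m + n" "\<not> i < m \<Longrightarrow> \<pi> (n + i) = n + i"
      if "\<pi> permutes {n..<n + m}" for \<pi> i
      using permutes_in_image[OF that, of "n + i"] permutes_not_in[OF that, of "n + i"]
      by (cases "i < m"; auto)+
    have "bij_betw (\<lambda>i. \<tau> (n + i) - n) {..<m} {..<m}"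
      by (rule bij_betwI[of _ _ _ "\<lambda>i. inv_into UNIV \<tau> (n + i) - n"])
        (use ge[OF \<tau>] ge[OF inv] permutes_inverses[OF \<tau>] in \<open>auto simp: less_diff_conv2\<close>)
    moreover have "\<tau> (n + i) - n = i" if "i \<notin> {..<m}" for i
      using that ge(3)[OF \<tau>, of i] by simp
    ultimately have "(\<lambda>i. \<tau> (n + i) - n) permutes {..<m}"
      by (rule bij_imp_permutes)
    then show "(\<lambda>i. \<tau> (n + i) - n) \<in> {\<tau>. \<tau> permutes {..<m}}"
      by simp
  qed
  show "shift_perm n (\<lambda>i. \<tau> (n + i) - n) = \<tau>" if "\<tau> \<in> {\<tau>. \<tau> permutes {n..<n + m}}" for \<tau>
  proof
    fix i
    have \<tau>: "\<tau> permutes {n..<n + m}" using that by simp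
    show "shift_perm n (\<lambda>i. \<tau> (n + i) - n) i = \<tau> i"
      using permutes_in_image[OF \<tau>, of i] permutes_not_in[OF \<tau>, of i]
      by (cases "i \<in> {n..<n + m}") (auto simp: shift_perm_def)
  qed
qed (auto simp: shift_perm_permutes, auto simp: shift_perm_def)

text \<open>The bridge from the tensor product of diagrams on \<open>n\<close> and on
  \<open>m\<close> strands to a product in one group algebra of rank \<open>n + m\<close>, namely to
  \<open>K\<close>.\<close>

lemma tens_symm_alt:
  "tens (mor_of n (symm {..<n})) (mor_of m (alt {..<m})) =
    (mor_of (n + m) (symm {..<n} * alt {n..<n + m}) :: 'k::field mor)"
proof -
  let ?P = "\<lambda>A :: nat set. {\<sigma>. \<sigma> permutes A}"
  have L: "\<sigma> permutes {..<n + m}" if "\<sigma> permutes {..<n}" for \<sigma>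
    using that by (rule permutes_subset) auto
  have R: "\<sigma> permutes {..<n + m}" if "\<sigma> permutes {n..<n + m}" for \<sigma>
    using that by (rule permutes_subset) auto
  have "mor_of (n + m) (symm {..<n} * alt {n..<n + m} :: 'k alg) =
      mor_of (n + m) (symm {..<n}) * mor_of (n + m) (alt {n..<n + m})"
    by (intro mor_of_mult range_emb_symm range_emb_alt) auto
  also have "mor_of (n + m) (symm {..<n}) = (\<Sum>\<sigma>\<in>?P {..<n}. perm_mor (n + m) \<sigma> :: 'k mor)"
    unfolding symm_def mor_of_sum by (intro sum.cong) (auto simp: mor_of_grp L)
  also have "mor_of (n + m) (alt {n..<n + m}) =
      (\<Sum>\<tau>\<in>?P {n..<n + m}. scale (of_int (sign \<tau>)) (perm_mor (n + m) \<tau>) :: 'k mor)"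
    unfolding alt_def mor_of_sum by (intro sum.cong) (auto simp: mor_of_scl mor_of_grp R)
  also have "\<dots> =
      (\<Sum>\<tau>\<in>?P {..<m}. scale (of_int (sign \<tau>)) (perm_mor (n + m) (shift_perm n \<tau>)))"
    by (subst sum.reindex_bij_betw[OF bij_betw_shift_perm, symmetric])
      (auto simp: sign_shift_perm intro!: sum.cong)
  also have "(\<Sum>\<sigma>\<in>?P {..<n}. perm_mor (n + m) \<sigma>) * \<dots> = (\<Sum>\<sigma>\<in>?P {..<n}. \<Sum>\<tau>\<in>?P {..<m}.
      scale (of_int (sign \<tau>)) (tens (perm_mor n \<sigma>) (perm_mor m \<tau>)) :: 'k mor)"
    unfolding sum_product
    by (intro sum.cong) (auto simp: tens_perm_mor perm_mor_compose L R shift_perm_permutes)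
  also have "\<dots> = tens (mor_of n (symm {..<n})) (mor_of m (alt {..<m}))"
    unfolding symm_def alt_def mor_of_sum tens_sum_left tens_sum_right
    by (subst sum.swap, intro sum.cong) (auto simp: mor_of_grp mor_of_scl)
  finally show ?thesis by (rule HOL.sym)
qed

section \<open>Objects and matrices\<close>

lemma single_mult: "single f * single g = single (f * g)"
  by (rule eq_matI) (auto simp: Defs.single_def scalar_prod_def)

lemma single_add: "single f + single g = single (f + g)"
  by (rule eq_matI) (auto simp: Defs.single_def)

lemma single_0: "single 0 = 0\<^sub>m 1 1"
  by (rule eq_matI) (auto simp: Defs.single_def)

lemma ascale_single: "ascale c (single f) = single (scale c f)"
  by (rule eq_matI) (auto simp: Defs.single_def ascale_def)

lemma atens_single: "atens (single f) (single g) = single (tens f g)"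
  by (rule eq_matI) (auto simp: Defs.single_def atens_def)

lemma single_ahom: "f \<in> whom X Y \<Longrightarrow> single f \<in> ahom [X] [Y]"
  by (auto simp: ahom_def Defs.single_def)

lemma ahom_carrier: "f \<in> ahom Xs Ys \<Longrightarrow> f \<in> carrier_mat (length Ys) (length Xs)"
  by (simp add: ahom_def)

lemma ahom_four_block:
  assumes "A \<in> ahom Xs Ys" "B \<in> ahom Xs' Ys" "C \<in> ahom Xs Ys'" "D \<in> ahom Xs' Ys'"
  shows "four_block_mat A B C D \<in> ahom (Xs @ Xs') (Ys @ Ys')"
  using assms by (auto simp: ahom_def nth_append)

lemma zero_ahom: "0\<^sub>m (length Ys) (length Xs) \<in> ahom Xs Ys"
  by (auto simp: ahom_def)

text \<open>Empty blocks let rows and columns of morphisms be multiplied by the rule for four-block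
  matrices.\<close>

lemma four_block_empty:
  assumes "A \<in> carrier_mat n k"
  shows "four_block_mat A (0\<^sub>m n 0) (0\<^sub>m 0 k) (0\<^sub>m 0 0) = A"
  using assms by (intro eq_matI) auto

text \<open>\<open>hhom\<close> records only the two-sided condition; idempotency splits it.\<close>

lemma idem_absorb:
  fixes x :: "'a::semiring_0 mat"
  assumes "a \<in> carrier_mat k k" "x \<in> carrier_mat k l" "b \<in> carrier_mat l l"
    and "a * a = a" "b * b = b" "a * x * b = x"
  shows "a * x = x" "x * b = x"
proof -
  have "a * x = a * (a * x * b)" using assms by simp
  also have "\<dots> = a * (a * (x * b))" using assms by (simp add: assoc_mult_mat[of a k k x l b l])
  also have "\<dots> = a * a * (x * b)" using assms by (intro assoc_mult_mat[symmetric]) auto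
  also have "\<dots> = x" using assms by (simp add: assoc_mult_mat[of a k k x l b l])
  finally show "a * x = x" .
  have "x * b = a * x * b * b" using assms by simp
  also have "\<dots> = a * x * (b * b)" using assms by (intro assoc_mult_mat) auto
  finally show "x * b = x" using assms by simp
qed

text \<open>The biproduct data form mutually inverse matrices: the projections as a column
  \<open>f\<close>, the inclusions as a row \<open>g\<close>. One composite is the resolution of the
  identity, the other has the orthogonality relations as its entries.\<close>

lemma hiso_hsum:
  fixes A B C :: "'k::field hobj"
  assumes obj: "A \<in> hobj" "B \<in> hobj" "C \<in> hobj"
    and i: "i1 \<in> hhom B A" "i2 \<in> hhom C A"
    and p: "p1 \<in> hhom A B" "p2 \<in> hhom A C"
    and id: "p1 * i1 = hid B" "p2 * i2 = hid C" "i1 * p1 + i2 * p2 = hid A"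
    and zero: "p1 * i2 = hzero C B" "p2 * i1 = hzero B C"
  shows "hiso A (hsum B C)"
proof -
  obtain As a where A: "A = (As, a)" by (cases A)
  obtain Bs b where B: "B = (Bs, b)" by (cases B)
  obtain Cs c where C: "C = (Cs, c)" by (cases C)
  define na nb nc where "na = length As" "nb = length Bs" "nc = length Cs"
  have hom: "a \<in> ahom As As" "b \<in> ahom Bs Bs" "c \<in> ahom Cs Cs"
    "i1 \<in> ahom Bs As" "i2 \<in> ahom Cs As" "p1 \<in> ahom As Bs" "p2 \<in> ahom As Cs"
    using obj i p by (auto simp: hobj_def hhom_def A B C)
  have car: "a \<in> carrier_mat na na" "b \<in> carrier_mat nb nb" "c \<in> carrier_mat nc nc"
    "i1 \<in> carrier_mat na nb" "i2 \<in> carrier_mat na nc" "p1 \<in> carrier_mat nb na" "p2 \<in> carrier_mat nc na"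
    using hom[THEN ahom_carrier] by (simp_all add: na_nb_nc_def)
  have idem: "a * a = a" "b * b = b" "c * c = c"
    using obj by (auto simp: hobj_def A B C)
  have "a * i1 * b = i1" "a * i2 * c = i2" "b * p1 * a = p1" "c * p2 * a = p2"
    using i p by (simp_all add: hhom_def A B C)
  note absorb =
    idem_absorb[OF car(1,4,2) idem(1,2) this(1)] idem_absorb[OF car(1,5,3) idem(1,3) this(2)]
    idem_absorb[OF car(2,6,1) idem(2,1) this(3)] idem_absorb[OF car(3,7,1) idem(3,1) this(4)]
  define f where "f = four_block_mat p1 (0\<^sub>m nb 0) p2 (0\<^sub>m nc 0)"
  define g where "g = four_block_mat i1 i2 (0\<^sub>m 0 nb) (0\<^sub>m 0 nc)"
  define s where "s = four_block_mat b (0\<^sub>m nb nc) (0\<^sub>m nc nb) c"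
  have S: "hsum B C = (Bs @ Cs, s)"
    by (simp add: hsum_def B C hzero_def s_def na_nb_nc_def)
  have f_hom: "f \<in> ahom As (Bs @ Cs)"
    using ahom_four_block[OF hom(6) zero_ahom[of Bs "[]"] hom(7) zero_ahom[of Cs "[]"]]
    by (simp add: f_def na_nb_nc_def)
  have g_hom: "g \<in> ahom (Bs @ Cs) As"
    using ahom_four_block[OF hom(4) hom(5) zero_ahom[of "[]" Bs] zero_ahom[of "[]" Cs]]
    by (simp add: g_def na_nb_nc_def)
  have s_hom: "s \<in> ahom (Bs @ Cs) (Bs @ Cs)"
    using ahom_four_block[OF hom(2) zero_ahom[of Bs Cs] zero_ahom[of Cs Bs] hom(3)]
    by (simp add: s_def na_nb_nc_def)
  note z = zero_carrier_mat
  \<comment> \<open>Composing with \<open>a\<close> requires \<open>a\<close> itself to be written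
    with empty blocks.\<close>
  note a' = four_block_empty[OF car(1), symmetric]
  have gf: "g * f = a"
  proof -
    have "g * f = four_block_mat (i1 * p1 + i2 * p2) (0\<^sub>m na 0) (0\<^sub>m 0 na) (0\<^sub>m 0 0)"
      unfolding f_def g_def
      by (subst mult_four_block_mat[OF car(4,5) z z car(6) z car(7) z]) (use car in auto)
    also have "i1 * p1 + i2 * p2 = a"
      using id(3) by (simp add: hid_def A)
    finally show ?thesis by (simp add: four_block_empty[OF car(1)])
  qed
  have fg: "f * g = s"
    using id zero car unfolding f_def g_def s_def
    by (subst mult_four_block_mat[OF car(6) z car(7) z car(4,5) z z])
      (auto simp: hid_def hzero_def A B C na_nb_nc_def)
  have sf: "s * f = f"
    unfolding f_def s_def
    by (subst mult_four_block_mat[OF car(2) z z car(3) car(6) z car(7) z]) (use car absorb in auto)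
  have gs: "g * s = g"
    unfolding g_def s_def
    by (subst mult_four_block_mat[OF car(4,5) z z car(2) z z car(3)]) (use car absorb in auto)
  have fa: "f * a = f"
    unfolding f_def
    by (subst a', subst mult_four_block_mat[OF car(6) z car(7) z car(1) z z z]) (use car absorb in auto)
  have ag: "a * g = g"
    unfolding g_def
    by (subst a', subst mult_four_block_mat[OF car(1) z z z car(4,5) z z]) (use car absorb in auto)
  have "s * s = s"
    unfolding s_def
    by (subst mult_four_block_mat[OF car(2) z z car(3) car(2) z z car(3)]) (use car idem in auto)
  then have "hsum B C \<in> hobj" using s_hom by (simp add: hobj_def S)
  moreover have "f \<in> hhom A (hsum B C)" "g \<in> hhom (hsum B C) A"
    using f_hom g_hom by (simp_all add: hhom_def S A sf gs fa ag)
  ultimately show ?thesis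
    using obj(1) gf fg unfolding hiso_def by (auto simp: hid_def S A)
qed

lemma single_hhom:
  assumes "f \<in> whom X Y" "b * f * a = f"
  shows "single f \<in> hhom ([X], single a) ([Y], single b)"
  using assms by (simp add: hhom_def single_ahom single_mult)

theorem proposition4p7:
  fixes n m :: nat
    and iota_m iota_m1 rho_m rho_m1 ha :: "'k::field_char_0 mor mat"
    and PP P_m P_m1 :: "'k hobj"
  assumes "n \<ge> 1" and "m > 1"
    and "PP = htens (P_sym n) (P_alt m)"
    and "P_m = P_part (hook n m)"
    and "P_m1 = P_part (hook (n + 1) (m - 1))"
    and "ha = atens (h_idem n) (a_idem m)"
    and "iota_m = ha * e_idem (hook n m)"
    and "iota_m1 = ascale (of_nat m) (ha * e_idem (hook (n + 1) (m - 1)))"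
    and "rho_m = e_idem (hook n m) * ha"
    and "rho_m1 = e_idem (hook (n + 1) (m - 1)) * ha"
  shows "PP \<in> hobj \<and> P_m \<in> hobj \<and> P_m1 \<in> hobj \<and>
    iota_m \<in> hhom P_m PP \<and> iota_m1 \<in> hhom P_m1 PP \<and>
    rho_m \<in> hhom PP P_m \<and> rho_m1 \<in> hhom PP P_m1 \<and>
    (rho_m * iota_m = hid P_m \<and> rho_m1 * iota_m1 = hid P_m1) \<and>
    (rho_m * iota_m1 = hzero P_m1 P_m \<and> rho_m1 * iota_m = hzero P_m P_m1) \<and>
    hid PP = iota_m * rho_m + iota_m1 * rho_m1 \<and>
    hiso PP (hsum P_m P_m1)"
proof -
  define r where "r = n + m"
  have sets: "insert 0 {Suc 0..<n} = {..<n}" "insert n {Suc n..<n + m} = {n..<n + m}"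
      "insert n {..<n} = {..<Suc n}"
    and card: "Suc (card {Suc 0..<n}) = n" "Suc (card {Suc n..<n + m}) = m"
      "card {Suc 0..<n} = n - 1" "card {Suc n..<n + m} = m - 1" "2 + (n - 1) + (m - 1) = n + m"
    using assms(1,2) by auto
  \<comment> \<open>Strands count from \<open>0\<close>: the corner is \<open>0\<close>, and
    \<open>n\<close>, the first strand of the antisymmetrized block, is the box that passes from leg
    to row.\<close>
  interpret hook_sets 0 n "{Suc 0..<n}" "{Suc n..<n + m}"
    "symm {..<n} * alt {n..<n + m} :: 'k alg"
    "symm {..<n} * alt (insert 0 {n..<n + m})"
    "symm {..<Suc n} * alt (insert 0 {Suc n..<n + m})"
    "symm {..<n} * alt {n..<n + m} * tr 0 n * (symm {..<n} * alt {n..<n + m})"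
    using assms(1) unfolding hook_sets_def sets by auto
  note range_emb = range_emb_mult range_emb_scl range_emb_symm range_emb_alt
  have r: "H \<in> range (emb r)" "E \<in> range (emb r)" "E' \<in> range (emb r)"
    unfolding H_def E_def E'_def r_def using assms(1,2) by (auto intro!: range_emb)
  define h e e' where "h = mor_of r H" and "e = mor_of r E" and "e' = mor_of r E'"
  have hom: "h \<in> whom (ups r) (ups r)" "e \<in> whom (ups r) (ups r)" "e' \<in> whom (ups r) (ups r)"
    unfolding h_def e_def e'_def by (rule mor_of_whom)+
  have prod: "mor_of r (x * y * z) = mor_of r x * mor_of r y * mor_of r z"
    if "x \<in> range (emb r)" "y \<in> range (emb r)" "z \<in> range (emb r)" for x y z :: "'k alg"
    using that by (simp add: mor_of_mult range_emb_mult)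
  have hh: "h * h = h" and ee: "e * e = e" and e'e': "e' * e' = e'"
    unfolding h_def e_def e'_def using r by (simp_all add: H_idem E_idem E'_idem flip: mor_of_mult)
  have ehe: "e * h * e = e" and ehe': "e * h * e' = 0" and e'he: "e' * h * e = 0"
    unfolding h_def e_def e'_def using r
    by (simp_all add: E_H_E E_H_E' E'_H_E mor_of_zero flip: prod)
  \<comment> \<open>The scalar \<open>m\<close> of \<open>iota_m1\<close> enters here and again in
    \<open>decomp\<close>.\<close>
  have e'he': "scale (of_nat m) (e' * h * e') = e'"
    unfolding h_def e'_def using r E'_H_E' by (simp only: card(2) flip: prod mor_of_scl)
  have decomp: "h * e * h + scale (of_nat m) (h * e' * h) = h"
    unfolding h_def e_def e'_def using r H_decomposition
    by (simp only: card(2) flip: prod mor_of_scl mor_of_add)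
  have ha: "ha = single h"
  proof -
    have "ha = single (mor_of r (scl (1 / fact n * (1 / fact m)) (symm {..<n} * alt {n..<n + m})))"
      unfolding assms(6) h_idem_def a_idem_def grpalg_mor_emb emb_complete_sym emb_complete_antisym
        atens_single mor_of_scl r_def
      by (simp add: mult.commute flip: tens_symm_alt)
    then show ?thesis by (simp only: h_def H_def card(1,2)) simp
  qed
  have e: "e_idem (hook n m) = single e"
    unfolding e_idem_def grpalg_mor_emb sum_list_hook emb_young_idempotent_hook[OF assms(1)] e_def E_def
      card(1,2) r_def unfolding card(3-5) ..
  have e': "e_idem (hook (n + 1) (m - 1)) = single e'"
  proof -
    \<comment> \<open>Subtraction truncates, so the bound on \<open>m\<close> is what gives the
      second hook the size \<open>n + m\<close>.\<close>
    have *: "Suc n + (m - 1) = n + m" "Suc n - 1 = n" "n + 1 = Suc n" using assms(2) by auto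
    show ?thesis
      using emb_young_idempotent_hook[of "n + 1" "m - 1", where 'k = 'k]
      unfolding e_idem_def grpalg_mor_emb sum_list_hook e'_def E'_def card(1,2) r_def
      unfolding card(3-5)
      by (simp only: * le_add2 flip: One_nat_def)
  qed
  have PP: "PP = ([ups r], single h)"
    unfolding assms(3) htens_def P_sym_def P_alt_def fst_conv snd_conv assms(6)[symmetric] ha
    by (simp add: atens_obj_def r_def ups_add)
  have P_m: "P_m = ([ups r], single e)"
    by (simp add: assms(4) P_part_def e r_def)
  have P_m1: "P_m1 = ([ups r], single e')"
    using assms(2) by (simp add: assms(5) P_part_def e'[simplified] r_def)
  have maps: "iota_m = single (h * e)" "iota_m1 = single (scale (of_nat m) (h * e'))"
    "rho_m = single (e * h)" "rho_m1 = single (e' * h)"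
    by (simp_all only: assms(7-10) ha e e' single_mult ascale_single)
  have hh_left: "h * (h * x) = h * x" for x by (simp add: hh flip: mult.assoc)
  have obj: "PP \<in> hobj" "P_m \<in> hobj" "P_m1 \<in> hobj"
    using hom by (simp_all add: hobj_def PP P_m P_m1 single_ahom single_mult hh ee e'e')
  have hhom: "iota_m \<in> hhom P_m PP" "iota_m1 \<in> hhom P_m1 PP" "rho_m \<in> hhom PP P_m" "rho_m1 \<in> hhom PP P_m1"
    unfolding PP P_m P_m1 maps using hom
    by (auto intro!: single_hhom times_whom scale_whom simp: mult.assoc hh hh_left ee e'e')
      (simp_all add: hh hh_left ee e'e' flip: mult.assoc)
  have inv: "rho_m * iota_m = hid P_m" "rho_m1 * iota_m1 = hid P_m1"
    using ehe e'he' by (simp_all add: maps P_m P_m1 hid_def single_mult mult.assoc hh_left)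
  have zero: "rho_m * iota_m1 = hzero P_m1 P_m" "rho_m1 * iota_m = hzero P_m P_m1"
    using ehe' e'he
    by (simp_all add: maps P_m P_m1 hzero_def single_mult mult.assoc hh_left single_0[simplified])
  have sum: "iota_m * rho_m + iota_m1 * rho_m1 = hid PP"
  proof -
    have "h * e * (e * h) = h * e * h" "h * e' * (e' * h) = h * e' * h"
      by (metis ee e'e' mult.assoc)+
    then show ?thesis
      using decomp by (simp add: maps PP hid_def single_mult single_add)
  qed
  show ?thesis
    using obj hhom inv zero sum hiso_hsum[OF obj hhom inv sum zero] by auto
qed

end
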